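(* Consider the cooperative pairwise-independent network (PIN) described in the context, with $M\ge 2$ relays. For $i\in\{1,\dots,M\}$ let $$I_i=\min\{I(Y_{i,A};Y_{A,i}),\,I(Y_{i,B};Y_{B,i})\},$$ and let $I_{(1)}\le I_{(2)}\le\dots\le I_{(M)}$ be these values in nondecreasing order. Then the private key capacity is $$C_K=\sum_{i=1}^M I_i-\max_{m\in\{1,\dots,M\}} I_m=\sum_{i=1}^{M-1} I_{(i)}.$$
   Context: Terminals: Alice, Bob, and relays $1,\dots,M$ ($M\ge 2$); plus a passive eavesdropper Eve. All alphabets are finite (discrete memoryless sources). For each $i\in\{1,\dots,M\}$ there are random variable pairs $(Y_{i,A},Y_{A,i})$ and $(Y_{i,B},Y_{B,i})$: Alice observes $X_A=(Y_{1,A},\dots,Y_{M,A})$, Bob observes $X_B=(Y_{1,B},\dots,Y_{M,B})$, relay $m$ observes $X_m=(Y_{A,m},Y_{B,m})$. The PIN assumption: the $2M$ pairs $(Y_{i,\alpha},Y_{\alpha,i})$, $i\in\{1,\dots,M\}$, $\alpha\in\{A,B\}$, are mutually independent (each pair $(Y_{i,\alpha},Y_{\alpha,i})$ is independent of the collection of all other pairs). Each terminal observes $n$ i.i.d. repetitions of its variable: $X_A^n, X_B^n, X_m^n$. Terminals communicate over a noiseless public channel of unlimited capacity, observed noiselessly by Eve, in $q$ rounds in round-robin order: in round $l$, relay $m$ transmits if $l\bmod (M+2)=m$, Alice if $l\bmod(M+2)=M+1$, Bob if $l\bmod(M+2)=0$; the transmitter generates $F_l\in\{1,\dots,2^{n\tilde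 R_l}\}$ according to $p(f_l\mid x^n,f^{l-1})$ where $x^n$ is its own observation and $f^{l-1}=(f_1,\dots,f_{l-1})$. After $q$ rounds, Alice computes $K_A=K_A(X_A^n,F^q)$ and Bob computes $K_B=K_B(X_B^n,F^q)$, with $F^q=(F_1,\dots,F_q)$. A rate $R$ is achievable if for every $\epsilon>0$ there exist $n$, $q$ and such a code with $\Pr(K_A\ne K_B)\le\epsilon$, $\frac1n H(K_A)\ge R-\epsilon$, $\frac1n H(K_A)\ge \frac1n\log|\mathcal K_A|-\epsilon$ (where $\mathcal K_A$ is the key alphabet), and $\frac1n I(K_A;X_m^n,F^q)\le\epsilon$ for every $m\in\{1,\dots,M\}$ (the key is secret from Eve and from each individual relay, relays non-colluding). The private key capacity $C_K$ is the supremum of achievable rates. *)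

theory Defs
  imports "HOL-Probability.Probability"
begin

datatype party = PA | PB

datatype terminal = Alice | Bob | Relay nat

definition transmitter :: "nat \<Rightarrow> nat \<Rightarrow> terminal" where
  "transmitter M l =
     (if l mod (M + 2) = M + 1 then Alice
      else if l mod (M + 2) = 0 then Bob
      else Relay (l mod (M + 2)))"

text \<open>A sample of the whole source over n time instants:
  omega t (i, alpha) = (Y_{i,alpha}, Y_{alpha,i}) at time t.\<close>
type_synonym 'a sample = "nat \<Rightarrow> nat \<times> party \<Rightarrow> 'a \<times> 'a"
type_synonym 'a view = "nat \<Rightarrow> nat \<times> party \<Rightarrow> 'a option"

definition pin_source :: "nat \<Rightarrow> nat \<Rightarrow> (nat \<Rightarrow> party \<Rightarrow> ('a \<times> 'a) pmf) \<Rightarrow> 'a sample pmf" where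
  "pin_source M n P =
     Pi_pmf {..<n} undefined
       (\<lambda>_. Pi_pmf ({1..M} \<times> {PA, PB}) undefined (\<lambda>(i, \<alpha>). P i \<alpha>))"

definition terminal_view :: "nat \<Rightarrow> nat \<Rightarrow> terminal \<Rightarrow> 'a sample \<Rightarrow> 'a view" where
  "terminal_view M n \<tau> \<omega> = (\<lambda>t (i, \<alpha>).
     if t < n \<and> 1 \<le> i \<and> i \<le> M then
       (case \<tau> of
          Alice \<Rightarrow> if \<alpha> = PA then Some (fst (\<omega> t (i, \<alpha>))) else None
        | Bob \<Rightarrow> if \<alpha> = PB then Some (fst (\<omega> t (i, \<alpha>))) else None
        | Relay m \<Rightarrow> if i = m then Some (snd (\<omega> t (i, \<alpha>))) else None)
     else None)"

primrec run_protocol ::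
  "nat \<Rightarrow> (nat \<Rightarrow> 'a view \<Rightarrow> nat list \<Rightarrow> nat pmf) \<Rightarrow> (terminal \<Rightarrow> 'a view) \<Rightarrow> nat \<Rightarrow> nat list pmf" where
  "run_protocol M \<phi> v 0 = return_pmf []"
| "run_protocol M \<phi> v (Suc l) =
     bind_pmf (run_protocol M \<phi> v l)
       (\<lambda>fs. map_pmf (\<lambda>f. fs @ [f]) (\<phi> (Suc l) (v (transmitter M (Suc l))) fs))"

definition outcome ::
  "nat \<Rightarrow> nat \<Rightarrow> (nat \<Rightarrow> party \<Rightarrow> ('a \<times> 'a) pmf) \<Rightarrow> nat
   \<Rightarrow> (nat \<Rightarrow> 'a view \<Rightarrow> nat list \<Rightarrow> nat pmf) \<Rightarrow> ('a sample \<times> nat list) pmf" where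
  "outcome M n P q \<phi> =
     bind_pmf (pin_source M n P)
       (\<lambda>\<omega>. map_pmf (\<lambda>fs. (\<omega>, fs)) (run_protocol M \<phi> (\<lambda>\<tau>. terminal_view M n \<tau> \<omega>) q))"

definition entropy_pmf :: "'b pmf \<Rightarrow> real" where
  "entropy_pmf p = - (\<Sum>x\<in>set_pmf p. pmf p x * log 2 (pmf p x))"

definition mutual_info_pmf :: "'c pmf \<Rightarrow> ('c \<Rightarrow> 'x) \<Rightarrow> ('c \<Rightarrow> 'y) \<Rightarrow> real" where
  "mutual_info_pmf p X Y =
     (let J = map_pmf (\<lambda>w. (X w, Y w)) p in
      (\<Sum>(x, y)\<in>set_pmf J.
         pmf J (x, y) * log 2 (pmf J (x, y) / (pmf (map_pmf X p) x * pmf (map_pmf Y p) y))))"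

definition achievable :: "nat \<Rightarrow> (nat \<Rightarrow> party \<Rightarrow> ('a \<times> 'a) pmf) \<Rightarrow> real \<Rightarrow> bool" where
  "achievable M P R \<longleftrightarrow>
     (\<forall>\<epsilon>>0. \<exists>(n::nat) (q::nat) (\<phi> :: nat \<Rightarrow> 'a view \<Rightarrow> nat list \<Rightarrow> nat pmf)
         (KA :: 'a view \<Rightarrow> nat list \<Rightarrow> nat) (KB :: 'a view \<Rightarrow> nat list \<Rightarrow> nat)
         (K :: nat set) (L :: nat).
        n > 0 \<and> finite K \<and> (\<forall>x fs. KA x fs \<in> K) \<and>
        (\<forall>l x fs. set_pmf (\<phi> l x fs) \<subseteq> {..<L}) \<and>
        (let \<Omega> = outcome M n P q \<phi>;
             keyA = (\<lambda>(\<omega>, fs). KA (terminal_view M n Alice \<omega>) fs);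
             keyB = (\<lambda>(\<omega>, fs). KB (terminal_view M n Bob \<omega>) fs)
         in measure_pmf.prob \<Omega> {w. keyA w \<noteq> keyB w} \<le> \<epsilon>
          \<and> entropy_pmf (map_pmf keyA \<Omega>) / real n \<ge> R - \<epsilon>
          \<and> entropy_pmf (map_pmf keyA \<Omega>) / real n \<ge> log 2 (real (card K)) / real n - \<epsilon>
          \<and> (\<forall>m\<in>{1..M}.
               mutual_info_pmf \<Omega> keyA
                 (\<lambda>(\<omega>, fs). (terminal_view M n (Relay m) \<omega>, fs)) / real n \<le> \<epsilon>)))"

definition private_key_capacity :: "nat \<Rightarrow> (nat \<Rightarrow> party \<Rightarrow> ('a \<times> 'a) pmf) \<Rightarrow> real" where
  "private_key_capacity M P = Sup {R. achievable M P R}"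

definition pin_rate :: "(nat \<Rightarrow> party \<Rightarrow> ('a \<times> 'a) pmf) \<Rightarrow> nat \<Rightarrow> real" where
  "pin_rate P i = min (mutual_info_pmf (P i PA) fst snd) (mutual_info_pmf (P i PB) fst snd)"

end

theory Submission
  imports Defs "HOL-Real_Asymp.Real_Asymp"
begin

text \<open>Converse: fix an eavesdropping relay \<open>m\<close> with observation \<open>Z\<close> and split the remaining terminals
  into a side \<open>U\<close> of Alice and a side \<open>V\<close> of Bob, putting every relay so that exactly its weaker link
  is cut. Given \<open>Z\<close> and the transcript, the mutual information between the two sides starts at \<open>n\<close>
  times the sum of \<open>I\<^sub>i\<close> over \<open>i \<noteq> m\<close> and no public message can increase it, while by Fano's inequality
  it bounds the entropy of a key that both sides compute and that is secret from \<open>Z\<close>.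

  Achievability: every relay \<open>i\<close> publishes once a random bin index of its whole observation \<open>X\<^sub>i\<close> at a
  rate just above \<open>H(X\<^sub>i) - I\<^sub>i\<close>. This suffices for Alice and for Bob to decode all of \<open>X\<^sub>1, \<dots>, X\<^sub>M\<close>. Relay \<open>m\<close>
  and the bin indices leave an uncertainty of rate \<open>I\<^sub>i\<close> about each other \<open>X\<^sub>i\<close>, and these
  uncertainties add up by independence. A random function of \<open>(X\<^sub>1, \<dots>, X\<^sub>M)\<close> of the smallest of these
  total rates is then nearly uniform given the knowledge of any single relay.\<close>

section \<open>Entropy of finitely supported distributions\<close>

text \<open>Entropies are those of functions on one finite sample space, each the mean of the
  negative log-probability at the sample point. Conditional entropies and mutual informations are
  differences of such means, and the main inequalities between them come from Gibbs' inequality by a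
  choice of reference kernel. The obstacle in the converse is randomized encoding: a message is not
  a function of the sender's observation. But given any view that contains the sender's, a message
  has the same conditional entropy, that of the private randomness. So in the conditional mutual
  information of the two sides the increments on the sender's side cancel, and the remaining ones
  have the right sign. In the achievability part one choice has to serve two decoders, or all
  eavesdropping relays, at once: the nonnegative failure terms are added up before averaging over
  functions, which costs a constant factor. The bin maps are fixed before the key function is drawn,
  and the secrecy estimate uses only the number of their values, so the two random choices never
  interact.\<close>

definition ent :: "'w pmf \<Rightarrow> ('w \<Rightarrow> 'x) \<Rightarrow> real" where
  "ent p X = - (\<Sum>w\<in>set_pmf p. pmf p w * log 2 (pmf (map_pmf X p) (X w)))"

lemma pmf_map_pos: "w \<in> set_pmf p \<Longrightarrow> 0 < pmf (map_pmf X p) (X w)"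
  by (simp add: pmf_positive)

lemma prob_eq_sum:
  assumes "finite (set_pmf p)"
  shows "measure_pmf.prob p A = (\<Sum>w\<in>set_pmf p. pmf p w * (if w \<in> A then 1 else 0))"
proof -
  have "measure_pmf.prob p A = measure_pmf.prob p (A \<inter> set_pmf p)"
    by (simp add: measure_Int_set_pmf)
  also have "\<dots> = (\<Sum>w\<in>A \<inter> set_pmf p. pmf p w)"
    using assms by (intro measure_measure_pmf_finite) auto
  also have "\<dots> = (\<Sum>w\<in>set_pmf p. pmf p w * (if w \<in> A then 1 else 0))"
    using assms by (intro sum.mono_neutral_cong_left) auto
  finally show ?thesis .
qed

lemma sum_pmf_map:
  fixes g :: "'x \<Rightarrow> real"
  assumes fin: "finite (set_pmf p)"
  shows "(\<Sum>w\<in>set_pmf p. pmf p w * g (X w)) = (\<Sum>x\<in>X ` set_pmf p. pmf (map_pmf X p) x * g x)"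
proof -
  have "(\<Sum>w\<in>set_pmf p. pmf p w * g (X w)) = measure_pmf.expectation p (\<lambda>w. g (X w))"
    using fin by (subst integral_measure_pmf_real[where A="set_pmf p"]) (auto simp: mult.commute)
  also have "\<dots> = measure_pmf.expectation (map_pmf X p) g"
    by (rule integral_map_pmf[symmetric])
  also have "\<dots> = (\<Sum>x\<in>X ` set_pmf p. pmf (map_pmf X p) x * g x)"
    using fin by (subst integral_measure_pmf_real[where A="X ` set_pmf p"]) (auto simp: mult.commute)
  finally show ?thesis .
qed

lemma ent_map_pmf:
  assumes "finite (set_pmf p)"
  shows "ent (map_pmf g p) X = ent p (X \<circ> g)"
proof -
  have "(\<Sum>w\<in>set_pmf (map_pmf g p). pmf (map_pmf g p) w * f w)
      = (\<Sum>w\<in>set_pmf p. pmf p w * f (g w))" for f :: "_ \<Rightarrow> real"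
    using sum_pmf_map[OF assms, of f g] by simp
  then show ?thesis
    by (simp add: ent_def pmf.map_comp)
qed

context
  fixes p :: "'w pmf"
  assumes fin: "finite (set_pmf p)"
begin

lemma ent_eq_entropy_pmf: "ent p X = entropy_pmf (map_pmf X p)"
  by (simp add: ent_def entropy_pmf_def sum_pmf_map[OF fin, of "\<lambda>x. log 2 (pmf (map_pmf X p) x)"])

lemma ent_eq_expectation:
  "ent p X = - measure_pmf.expectation p (\<lambda>w. log 2 (pmf (map_pmf X p) (X w)))"
  using fin by (simp add: ent_def integral_measure_pmf_real[where A="set_pmf p"] mult.commute)

lemma mutual_info_eq_ent:
  "mutual_info_pmf p X Y = ent p X + ent p Y - ent p (\<lambda>w. (X w, Y w))"
proof -
  let ?J = "map_pmf (\<lambda>w. (X w, Y w)) p"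
  have "mutual_info_pmf p X Y = (\<Sum>z\<in>(\<lambda>w. (X w, Y w)) ` set_pmf p. pmf ?J z *
      log 2 (pmf ?J z / (pmf (map_pmf X p) (fst z) * pmf (map_pmf Y p) (snd z))))"
    by (simp add: mutual_info_pmf_def Let_def case_prod_unfold)
  also have "\<dots> = (\<Sum>w\<in>set_pmf p. pmf p w *
      log 2 (pmf ?J (X w, Y w) / (pmf (map_pmf X p) (X w) * pmf (map_pmf Y p) (Y w))))"
    by (subst sum_pmf_map[OF fin, symmetric]) simp
  also have "\<dots> = (\<Sum>w\<in>set_pmf p. pmf p w * log 2 (pmf ?J (X w, Y w))
      - pmf p w * log 2 (pmf (map_pmf X p) (X w)) - pmf p w * log 2 (pmf (map_pmf Y p) (Y w)))"
  proof (rule sum.cong[OF refl])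
    fix w assume w: "w \<in> set_pmf p"
    show "pmf p w * log 2 (pmf ?J (X w, Y w) / (pmf (map_pmf X p) (X w) * pmf (map_pmf Y p) (Y w)))
      = pmf p w * log 2 (pmf ?J (X w, Y w))
      - pmf p w * log 2 (pmf (map_pmf X p) (X w)) - pmf p w * log 2 (pmf (map_pmf Y p) (Y w))"
      using pmf_map_pos[OF w, of X] pmf_map_pos[OF w, of Y] pmf_map_pos[OF w, of "\<lambda>w. (X w, Y w)"]
      by (simp add: log_divide log_mult algebra_simps)
  qed
  finally show ?thesis by (simp add: ent_def sum_subtractf)
qed

text \<open>\<open>q\<close> is a family of sub-probability weights in \<open>x\<close>, one for
  each \<open>y\<close>; its cross-entropy dominates the conditional entropy by
  \<open>ln t \<le> t - 1\<close>. Submodularity, the cardinality bound and Fano's inequality are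
  three choices of \<open>q\<close>.\<close>

lemma gibbs:
  fixes q :: "'x \<Rightarrow> 'y \<Rightarrow> real"
  assumes pos: "\<And>w. w \<in> set_pmf p \<Longrightarrow> 0 < q (X w) (Y w)"
    and nonneg: "\<And>x y. 0 \<le> q x y"
    and sub: "\<And>y. (\<Sum>x\<in>X ` set_pmf p. q x y) \<le> 1"
  shows "ent p (\<lambda>w. (X w, Y w)) - ent p Y \<le> - (\<Sum>w\<in>set_pmf p. pmf p w * log 2 (q (X w) (Y w)))"
proof -
  let ?S = "set_pmf p" and ?J = "map_pmf (\<lambda>w. (X w, Y w)) p" and ?Q = "map_pmf Y p"
  have step: "pmf p w * (log 2 (q (X w) (Y w)) - log 2 (pmf ?J (X w, Y w)) + log 2 (pmf ?Q (Y w)))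
      \<le> (pmf p w * (q (X w) (Y w) * pmf ?Q (Y w) / pmf ?J (X w, Y w)) - pmf p w) / ln 2"
    if w: "w \<in> ?S" for w
  proof -
    have p: "0 < pmf ?J (X w, Y w)" "0 < pmf ?Q (Y w)"
      using pmf_map_pos[OF w, of "\<lambda>w. (X w, Y w)"] pmf_map_pos[OF w, of Y] by auto
    let ?r = "q (X w) (Y w) * pmf ?Q (Y w) / pmf ?J (X w, Y w)"
    have r: "?r > 0" using p pos[OF w] by simp
    have "log 2 (q (X w) (Y w)) - log 2 (pmf ?J (X w, Y w)) + log 2 (pmf ?Q (Y w)) = log 2 ?r"
      using p pos[OF w] by (simp add: log_divide log_mult)
    also have "\<dots> = ln ?r / ln 2" by (simp add: log_def)
    also have "\<dots> \<le> (?r - 1) / ln 2"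
      using ln_le_minus_one[OF r] by (simp add: divide_right_mono)
    finally have "pmf p w * (log 2 (q (X w) (Y w)) - log 2 (pmf ?J (X w, Y w)) + log 2 (pmf ?Q (Y w)))
        \<le> pmf p w * ((?r - 1) / ln 2)"
      by (rule mult_left_mono) simp
    then show ?thesis by (simp add: right_diff_distrib)
  qed
  have "(\<Sum>w\<in>?S. pmf p w * (q (X w) (Y w) * pmf ?Q (Y w) / pmf ?J (X w, Y w)))
      = (\<Sum>z\<in>(\<lambda>w. (X w, Y w)) ` ?S. pmf ?J z * (q (fst z) (snd z) * pmf ?Q (snd z) / pmf ?J z))"
    by (subst sum_pmf_map[OF fin, symmetric]) simp
  also have "\<dots> = (\<Sum>z\<in>(\<lambda>w. (X w, Y w)) ` ?S. q (fst z) (snd z) * pmf ?Q (snd z))"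
    by (rule sum.cong) (auto simp: pmf_map_pos[of _ p "\<lambda>w. (X w, Y w)"] less_imp_neq[symmetric])
  \<comment> \<open>Pairs outside the joint support are added, at nonnegative cost, so that the sum
    over \<open>x\<close> can be carried out for each \<open>y\<close> on its own.\<close>
  also have "\<dots> \<le> (\<Sum>z\<in>X ` ?S \<times> Y ` ?S. q (fst z) (snd z) * pmf ?Q (snd z))"
    by (rule sum_mono2) (use fin nonneg in auto)
  also have "\<dots> = (\<Sum>y\<in>Y ` ?S. (\<Sum>x\<in>X ` ?S. q x y) * pmf ?Q y)"
    unfolding sum_distrib_right
    by (subst sum.swap) (simp add: sum.cartesian_product case_prod_unfold)
  also have "\<dots> \<le> (\<Sum>y\<in>Y ` ?S. 1 * pmf ?Q y)"
    by (intro sum_mono mult_right_mono sub) auto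
  also have "\<dots> = 1" using fin by (simp add: sum_pmf_eq_1)
  finally have le: "(\<Sum>w\<in>?S. pmf p w * (q (X w) (Y w) * pmf ?Q (Y w) / pmf ?J (X w, Y w))) \<le> 1" .
  have "(\<Sum>w\<in>?S. pmf p w * (log 2 (q (X w) (Y w)) - log 2 (pmf ?J (X w, Y w)) + log 2 (pmf ?Q (Y w))))
     \<le> (\<Sum>w\<in>?S. (pmf p w * (q (X w) (Y w) * pmf ?Q (Y w) / pmf ?J (X w, Y w)) - pmf p w) / ln 2)"
    by (intro sum_mono step)
  also have "\<dots> \<le> 0"
    using le fin by (simp add: sum_divide_distrib[symmetric] sum_subtractf sum_pmf_eq_1 divide_le_0_iff)
  finally show ?thesis
    by (simp add: ent_def algebra_simps sum.distrib sum_subtractf sum_negf)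
qed

text \<open>On the support a fibre of \<open>Y\<close> lies inside a fibre of \<open>X\<close>, so
  the inequality holds at each sample point.\<close>

lemma ent_mono:
  assumes "\<And>w w'. w \<in> set_pmf p \<Longrightarrow> w' \<in> set_pmf p \<Longrightarrow> Y w = Y w' \<Longrightarrow> X w = X w'"
  shows "ent p X \<le> ent p Y"
proof -
  have "pmf (map_pmf Y p) (Y w) \<le> pmf (map_pmf X p) (X w)" if w: "w \<in> set_pmf p" for w
  proof -
    have "measure_pmf.prob p (Y -` {Y w}) \<le> measure_pmf.prob p (X -` {X w})"
      by (rule measure_pmf.finite_measure_mono_AE)
        (auto simp: AE_measure_pmf_iff intro: assms w)
    then show ?thesis by (simp add: pmf_map)
  qed
  then show ?thesis unfolding ent_def
    by (auto intro!: sum_mono mult_left_mono simp: pmf_map_pos)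
qed

text \<open>Only the partition of the support matters. This rebrackets tuples and exchanges
  equivalent encodings of an observation.\<close>

lemma ent_cong:
  assumes "\<And>w w'. w \<in> set_pmf p \<Longrightarrow> w' \<in> set_pmf p \<Longrightarrow> X w = X w' \<longleftrightarrow> Y w = Y w'"
  shows "ent p X = ent p Y"
  by (intro antisym ent_mono) (use assms in blast)+

lemma ent_submodular:
  "ent p (\<lambda>w. (X w, Y w, Z w)) + ent p Z \<le> ent p (\<lambda>w. (X w, Z w)) + ent p (\<lambda>w. (Y w, Z w))"
proof -
  \<comment> \<open>The reference kernel is the conditional law of \<open>X\<close> given
    \<open>Z\<close>, which ignores \<open>Y\<close>; its cross-entropy is exactly the conditional
    entropy of \<open>X\<close> given \<open>Z\<close>.\<close>
  let ?q = "\<lambda>x (y, z). pmf (map_pmf (\<lambda>w. (X w, Z w)) p) (x, z) / pmf (map_pmf Z p) z"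
  have sub: "(\<Sum>x\<in>X ` set_pmf p. ?q x y) \<le> 1" for y
  proof -
    obtain y' z where y: "y = (y', z)" by (cases y)
    have "(\<Sum>x\<in>X ` set_pmf p. pmf (map_pmf (\<lambda>w. (X w, Z w)) p) (x, z))
        = measure_pmf.prob (map_pmf (\<lambda>w. (X w, Z w)) p) ((\<lambda>x. (x, z)) ` X ` set_pmf p)"
      using fin by (subst measure_measure_pmf_finite) (auto simp: sum.reindex inj_on_def)
    also have "\<dots> \<le> pmf (map_pmf Z p) z"
      by (auto simp: pmf_map intro!: measure_pmf.finite_measure_mono)
    finally show ?thesis
      by (cases "pmf (map_pmf Z p) z = 0") (auto simp: y sum_divide_distrib[symmetric] divide_le_eq)
  qed
  have pos: "0 < pmf (map_pmf (\<lambda>w. (X w, Z w)) p) (X w, Z w)" "0 < pmf (map_pmf Z p) (Z w)"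
    if "w \<in> set_pmf p" for w
    using pmf_map_pos[OF that, of "\<lambda>w. (X w, Z w)"] pmf_map_pos[OF that, of Z] by auto
  have "ent p (\<lambda>w. (X w, (Y w, Z w))) - ent p (\<lambda>w. (Y w, Z w))
      \<le> - (\<Sum>w\<in>set_pmf p. pmf p w * log 2 (?q (X w) (Y w, Z w)))"
    by (rule gibbs) (use sub pos in \<open>auto split: prod.splits\<close>)
  also have "\<dots> = ent p (\<lambda>w. (X w, Z w)) - ent p Z"
  proof -
    have "(\<Sum>w\<in>set_pmf p. pmf p w * log 2 (?q (X w) (Y w, Z w)))
      = (\<Sum>w\<in>set_pmf p. pmf p w * log 2 (pmf (map_pmf (\<lambda>w. (X w, Z w)) p) (X w, Z w))
         - pmf p w * log 2 (pmf (map_pmf Z p) (Z w)))"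
    proof (rule sum.cong[OF refl])
      fix w assume "w \<in> set_pmf p"
      from pos[OF this]
      show "pmf p w * log 2 (?q (X w) (Y w, Z w))
        = pmf p w * log 2 (pmf (map_pmf (\<lambda>w. (X w, Z w)) p) (X w, Z w))
         - pmf p w * log 2 (pmf (map_pmf Z p) (Z w))"
        by (simp add: log_divide right_diff_distrib)
    qed
    then show ?thesis by (simp add: ent_def sum_subtractf)
  qed
  finally show ?thesis by simp
qed

text \<open>As \<open>Z\<close> is a function of \<open>Y\<close>, conditioning on \<open>Y\<close>
  is conditioning on both, and submodularity says that more conditioning lowers the entropy.\<close>

lemma ent_cond_antimono:
  "ent p (\<lambda>w. (X w, Y w)) - ent p Y \<le> ent p (\<lambda>w. (X w, Z w)) - ent p Z"
  if Z: "\<And>w w'. w \<in> set_pmf p \<Longrightarrow> w' \<in> set_pmf p \<Longrightarrow> Y w = Y w' \<Longrightarrow> Z w = Z w'"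
proof -
  have "ent p (\<lambda>w. (X w, Y w, Z w)) = ent p (\<lambda>w. (X w, Y w))"
    "ent p (\<lambda>w. (Y w, Z w)) = ent p Y"
    by (rule ent_cong; insert Z; blast)+
  then show ?thesis using ent_submodular[of X Y Z] by simp
qed

lemma ent_le_log_card:
  assumes K: "finite K" and "\<And>w. w \<in> set_pmf p \<Longrightarrow> X w \<in> K"
  shows "ent p X \<le> log 2 (card K)"
proof -
  have ne: "K \<noteq> {}" using assms(2) set_pmf_not_empty[of p] by blast
  have c: "card (X ` set_pmf p) \<le> card K" by (rule card_mono) (use assms in auto)
  have c0: "card K > 0" using K ne by (simp add: card_gt_0_iff)
  have "ent p (\<lambda>w. (X w, ())) - ent p (\<lambda>_. ()) \<le> - (\<Sum>w\<in>set_pmf p. pmf p w * log 2 (1 / card K))"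
    by (rule gibbs[where q="\<lambda>_ _. 1 / card K"]) (use c c0 in auto)
  moreover have "ent p (\<lambda>w. (X w, ())) = ent p X" by (rule ent_cong) auto
  moreover have "ent p (\<lambda>_. ()) = 0" by (simp add: ent_def pmf_map)
  moreover have "(\<Sum>w\<in>set_pmf p. pmf p w * log 2 (1 / card K)) = - log 2 (card K)"
    using c0 fin by (subst sum_distrib_right[symmetric]) (simp add: sum_pmf_eq_1 log_divide)
  ultimately show ?thesis by simp
qed

lemma fano:
  assumes K: "finite K" and XK: "\<And>w. w \<in> set_pmf p \<Longrightarrow> X w \<in> K"
    and e: "0 < e" "e < 1" and err: "measure_pmf.prob p {w. X w \<noteq> Y w} \<le> e"
  shows "ent p (\<lambda>w. (X w, Y w)) - ent p Y \<le> e * log 2 (card K) - log 2 (1 - e) - e * log 2 e"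
proof -
  have ne: "K \<noteq> {}" using XK set_pmf_not_empty[of p] by blast
  have c0: "card K > 0" using K ne by (simp add: card_gt_0_iff)
  \<comment> \<open>Gibbs' kernel for a guess that is right with probability about
    \<open>1 - e\<close>. Both logarithms are nonpositive, so their weights, the probabilities of a
    right and of a wrong guess, may be raised to \<open>1\<close> and \<open>e\<close>.\<close>
  let ?q = "\<lambda>x y. if x = y then 1 - e else e / card K"
  let ?P = "measure_pmf.prob p {w. X w \<noteq> Y w}"
  have sub: "(\<Sum>x\<in>X ` set_pmf p. ?q x y) \<le> 1" for y
  proof -
    have "(\<Sum>x\<in>X ` set_pmf p. ?q x y) \<le> (\<Sum>x\<in>K. (if x = y then 1 - e else 0) + e / card K)"
      using e c0 XK K by (intro order_trans[OF sum_mono2[of K "X ` set_pmf p" "\<lambda>x. ?q x y"]] sum_mono) auto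
    also have "\<dots> \<le> 1" using K c0 e by (simp add: sum.distrib)
    finally show ?thesis .
  qed
  have P: "?P = (\<Sum>w\<in>set_pmf p. pmf p w * (if X w \<noteq> Y w then 1 else 0))"
    by (simp add: prob_eq_sum[OF fin])
  have l1: "log 2 (1 - e) \<le> 0" using e by simp
  have l2: "log 2 (e / card K) \<le> 0" using e c0 by (simp add: log_le_zero_cancel_iff divide_le_eq)
  have "ent p (\<lambda>w. (X w, Y w)) - ent p Y \<le> - (\<Sum>w\<in>set_pmf p. pmf p w * log 2 (?q (X w) (Y w)))"
    by (rule gibbs[where q="?q"]) (use sub e c0 in auto)
  also have "\<dots> \<le> - (\<Sum>w\<in>set_pmf p. pmf p w * log 2 (1 - e)
      + (pmf p w * (if X w \<noteq> Y w then 1 else 0)) * log 2 (e / card K))"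
    unfolding neg_le_iff_le
    using l1 by (intro sum_mono) (auto simp: mult_nonneg_nonpos algebra_simps)
  also have "\<dots> = - log 2 (1 - e) - ?P * log 2 (e / card K)"
    unfolding P using fin by (simp add: sum.distrib sum_distrib_right[symmetric] sum_pmf_eq_1)
  also have "\<dots> \<le> - log 2 (1 - e) - e * log 2 (e / card K)"
    using err l2 by (simp add: mult_right_mono_neg)
  also have "\<dots> = e * log 2 (card K) - log 2 (1 - e) - e * log 2 e"
    using e c0 by (simp add: log_divide algebra_simps)
  finally show ?thesis .
qed

end

text \<open>The entropy increment caused by a message does not depend on the variable \<open>R\<close>, as long as
  \<open>R\<close> determines the law of the message.\<close>

lemma ent_kernel:
  fixes p :: "'s pmf" and \<kappa> :: "'s \<Rightarrow> 'f pmf"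
  assumes fin: "finite (set_pmf p)" "\<And>s. s \<in> set_pmf p \<Longrightarrow> finite (set_pmf (\<kappa> s))"
    and dep: "\<And>s s'. s \<in> set_pmf p \<Longrightarrow> s' \<in> set_pmf p \<Longrightarrow> R s = R s' \<Longrightarrow> \<kappa> s = \<kappa> s'"
  defines "p' \<equiv> bind_pmf p (\<lambda>s. map_pmf (Pair s) (\<kappa> s))"
  shows "ent p' (\<lambda>(s, f). (R s, f))
       = ent p R - (\<Sum>(s, f)\<in>set_pmf p'. pmf p' (s, f) * log 2 (pmf (\<kappa> s) f))"
proof -
  have fin': "finite (set_pmf p')" unfolding p'_def using fin by auto
  have mp: "map_pmf fst p' = p"
    by (simp add: p'_def map_bind_pmf pmf.map_comp o_def map_pmf_const bind_return_pmf')
  have Rp: "ent p R = ent p' (R \<circ> fst)"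
    using ent_map_pmf[OF fin', of fst R] by (simp add: mp)
  \<comment> \<open>Only the fibre of \<open>R\<close> through \<open>s\<close> contributes to the
    mixture, and on it the law of the message is constant, hence a common factor.\<close>
  have joint: "pmf (map_pmf (\<lambda>(s, f). (R s, f)) p') (R s, f) = pmf (map_pmf R p) (R s) * pmf (\<kappa> s) f"
    if s: "s \<in> set_pmf p" for s f
  proof -
    have "map_pmf (\<lambda>(s, f). (R s, f)) p' = bind_pmf p (\<lambda>s'. map_pmf (Pair (R s')) (\<kappa> s'))"
      by (simp add: p'_def map_bind_pmf pmf.map_comp o_def)
    then have "pmf (map_pmf (\<lambda>(s, f). (R s, f)) p') (R s, f)
        = measure_pmf.expectation p (\<lambda>s'. pmf (map_pmf (Pair (R s')) (\<kappa> s')) (R s, f))"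
      by (simp add: pmf_bind)
    also have "\<dots> = measure_pmf.expectation p (\<lambda>s'. indicator (R -` {R s}) s' * pmf (\<kappa> s) f)"
    proof (intro integral_cong_AE)
      show "AE s' in measure_pmf p. pmf (map_pmf (Pair (R s')) (\<kappa> s')) (R s, f)
          = indicator (R -` {R s}) s' * pmf (\<kappa> s) f"
      proof (simp add: AE_measure_pmf_iff, intro ballI)
        fix s' assume s': "s' \<in> set_pmf p"
        show "pmf (map_pmf (Pair (R s')) (\<kappa> s')) (R s, f) = indicator (R -` {R s}) s' * pmf (\<kappa> s) f"
        proof (cases "R s' = R s")
          case True
          then have "\<kappa> s' = \<kappa> s" using dep s s' by blast
          then show ?thesis using True
            by (simp add: pmf_map_inj'[of "Pair (R s)"] inj_on_def)
        next
          case False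
          then show ?thesis by (auto simp: pmf_eq_0_set_pmf)
        qed
      qed
    qed auto
    also have "\<dots> = pmf (map_pmf R p) (R s) * pmf (\<kappa> s) f"
      by (simp add: pmf_map)
    finally show ?thesis .
  qed
  have mR: "map_pmf (R \<circ> fst) p' = map_pmf R p"
    using mp by (metis pmf.map_comp)
  have "ent p' (\<lambda>(s, f). (R s, f)) = - (\<Sum>x\<in>set_pmf p'. pmf p' x *
     (log 2 (pmf (map_pmf R p) (R (fst x))) + log 2 (pmf (\<kappa> (fst x)) (snd x))))"
  proof (unfold ent_def neg_equal_iff_equal, rule sum.cong[OF refl])
    fix x assume x: "x \<in> set_pmf p'"
    obtain s f where [simp]: "x = (s, f)" by (cases x)
    have s: "s \<in> set_pmf p" "f \<in> set_pmf (\<kappa> s)" using x by (auto simp: p'_def)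
    show "pmf p' x * log 2 (pmf (map_pmf (\<lambda>(s, f). (R s, f)) p') (case x of (s, f) \<Rightarrow> (R s, f)))
      = pmf p' x * (log 2 (pmf (map_pmf R p) (R (fst x))) + log 2 (pmf (\<kappa> (fst x)) (snd x)))"
      using joint[OF s(1), of f] pmf_map_pos[OF s(1), of R] pmf_positive[OF s(2)]
      by (simp add: log_mult)
  qed
  also have "\<dots> = ent p' (R \<circ> fst) - (\<Sum>(s, f)\<in>set_pmf p'. pmf p' (s, f) * log 2 (pmf (\<kappa> s) f))"
    unfolding ent_def mR by (simp add: algebra_simps sum.distrib case_prod_unfold)
  finally show ?thesis by (simp add: Rp)
qed

section \<open>Partial views of the source\<close>

lemma expectation_Pi_pmf_component:
  fixes g :: "'b \<Rightarrow> real"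
  assumes "finite A" "t \<in> A"
  shows "measure_pmf.expectation (Pi_pmf A d p) (\<lambda>\<omega>. g (\<omega> t)) = measure_pmf.expectation (p t) g"
  using integral_map_pmf[of "\<lambda>\<omega>. \<omega> t" "Pi_pmf A d p" g] assms by (simp add: Pi_pmf_component)

lemma Pi_pmf_weak_law:
  fixes g :: "'b \<Rightarrow> real"
  assumes fin: "finite (set_pmf Q)" and \<delta>: "\<delta> > 0" and e: "e > 0"
  shows "\<forall>\<^sub>F n in sequentially. measure_pmf.prob (Pi_pmf {..<n} d (\<lambda>_. Q))
     {\<omega>. \<bar>(\<Sum>t<n. g (\<omega> t)) - real n * measure_pmf.expectation Q g\<bar> \<ge> real n * \<delta>} \<le> e"
proof -
  \<comment> \<open>The \<open>+ 1\<close> keeps \<open>a < b\<close> even for constant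
    \<open>g\<close>, so that the Hoeffding exponent has a nonzero denominator.\<close>
  define a b where "a = Min (g ` set_pmf Q)" and "b = Max (g ` set_pmf Q) + 1"
  have ab: "a \<le> g x" "g x \<le> b" if "x \<in> set_pmf Q" for x
  proof -
    have "g x \<le> Max (g ` set_pmf Q)" using fin that by simp
    then show "a \<le> g x" "g x \<le> b" using fin that by (auto simp: a_def b_def intro: add_increasing2)
  qed
  obtain x0 where x0: "x0 \<in> set_pmf Q" using set_pmf_not_empty by fastforce
  have "Max (g ` set_pmf Q) \<ge> g x0" using fin x0 by simp
  then have lt: "a < b" using ab[OF x0] by (simp add: b_def)
  have bound: "measure_pmf.prob (Pi_pmf {..<n} d (\<lambda>_. Q))
     {\<omega>. \<bar>(\<Sum>t<n. g (\<omega> t)) - real n * measure_pmf.expectation Q g\<bar> \<ge> real n * \<delta>}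
     \<le> 2 * exp (- (2 * \<delta>\<^sup>2 / (b - a)\<^sup>2) * real n)" if n: "n > 0" for n
  proof -
    let ?p = "Pi_pmf {..<n} d (\<lambda>_. Q)"
    interpret Hoeffding_ineq "measure_pmf ?p" "{..<n}" "\<lambda>t \<omega>. g (\<omega> t)" "\<lambda>_. a" "\<lambda>_. b"
      "real n * measure_pmf.expectation Q g"
    proof unfold_locales
      show "prob_space.indep_vars (measure_pmf ?p) (\<lambda>_. borel) (\<lambda>t \<omega>. g (\<omega> t)) {..<n}"
        by (intro prob_space.indep_vars_compose2[OF _ indep_vars_Pi_pmf])
          (auto simp: measure_pmf.prob_space_axioms)
    next
      fix t assume t: "t \<in> {..<n}"
      show "AE \<omega> in measure_pmf ?p. g (\<omega> t) \<in> {a..b}"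
        using t ab by (auto simp: AE_measure_pmf_iff set_Pi_pmf PiE_dflt_def)
    next
      show "real n * measure_pmf.expectation Q g
        \<equiv> \<Sum>t<n. measure_pmf.expectation ?p (\<lambda>\<omega>. g (\<omega> t))"
        by (rule eq_reflection) (simp add: expectation_Pi_pmf_component)
    qed simp
    have "measure_pmf.prob ?p {\<omega>. \<bar>(\<Sum>t<n. g (\<omega> t)) - real n * measure_pmf.expectation Q g\<bar> \<ge> real n * \<delta>}
      \<le> 2 * exp (- 2 * (real n * \<delta>)\<^sup>2 / (\<Sum>t<n. (b - a)\<^sup>2))"
      using Hoeffding_ineq_abs_ge[of "real n * \<delta>"] \<delta> n lt by simp
    also have "- 2 * (real n * \<delta>)\<^sup>2 / (\<Sum>t<n. (b - a)\<^sup>2) = - (2 * \<delta>\<^sup>2 / (b - a)\<^sup>2) * real n"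
      using n by (simp add: power_mult_distrib power2_eq_square[of "real n"] field_simps del: right_diff_distrib)
    finally show ?thesis .
  qed
  have "((\<lambda>n. 2 * exp (- (2 * \<delta>\<^sup>2 / (b - a)\<^sup>2) * real n)) \<longlongrightarrow> 2 * 0) sequentially"
  proof (intro tendsto_mult tendsto_const filterlim_compose[OF exp_at_bot])
    show "filterlim (\<lambda>n. - (2 * \<delta>\<^sup>2 / (b - a)\<^sup>2) * real n) at_bot sequentially"
      using \<delta> lt by (intro filterlim_tendsto_neg_mult_at_bot[OF tendsto_const] filterlim_real_sequentially)
        (simp_all add: divide_neg_pos)
  qed
  then have "\<forall>\<^sub>F n in sequentially. 2 * exp (- (2 * \<delta>\<^sup>2 / (b - a)\<^sup>2) * real n) < e"
    using e by (intro order_tendstoD(2)) auto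
  then show ?thesis
    using eventually_gt_at_top[of 0]
    by eventually_elim (use bound in \<open>auto intro: order_trans less_imp_le\<close>)
qed

text \<open>A mask lists the observed components of the source: the flag is \<open>False\<close> for
  \<open>Y\<^bsub>i,\<alpha>\<^esub>\<close> (held by Alice or Bob) and \<open>True\<close> for \<open>Y\<^bsub>\<alpha>,i\<^esub>\<close> (held by relay \<open>i\<close>).\<close>

type_synonym mask = "((nat \<times> party) \<times> bool) set"

definition links :: "nat \<Rightarrow> (nat \<times> party) set" where
  "links M = {1..M} \<times> {PA, PB}"

lemma finite_links [simp]: "finite (links M)"
  by (simp add: links_def)

definition sel :: "mask \<Rightarrow> nat \<times> party \<Rightarrow> 'a \<times> 'a \<Rightarrow> bool \<Rightarrow> 'a option" where
  "sel K b x = (\<lambda>s. if (b, s) \<in> K then Some (if s then snd x else fst x) else None)"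

text \<open>One encoding for the observation of any coalition: a union of masks is a joint
  observation, and equality of views is agreement on the masked components. Cut sides, decoders and
  eavesdroppers are then handled alike.\<close>

definition mview :: "nat \<Rightarrow> nat \<Rightarrow> mask \<Rightarrow> 'a sample \<Rightarrow> nat \<Rightarrow> nat \<times> party \<Rightarrow> bool \<Rightarrow> 'a option" where
  "mview M n K \<omega> = (\<lambda>t b. if t < n \<and> b \<in> links M then sel K b (\<omega> t b) else (\<lambda>_. None))"

definition mask_ent :: "nat \<Rightarrow> (nat \<Rightarrow> party \<Rightarrow> ('a \<times> 'a) pmf) \<Rightarrow> mask \<Rightarrow> real" where
  "mask_ent M P K = (\<Sum>b\<in>links M. ent (case_prod P b) (sel K b))"

text \<open>The log-likelihood of a view at one time instant. The log-probability of an
  \<open>n\<close>-letter view is a sum of i.i.d. copies of it with mean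
  \<open>- mask_ent M P K\<close>; its expectation gives the entropy, its concentration the
  equipartition property.\<close>

definition logletter :: "nat \<Rightarrow> (nat \<Rightarrow> party \<Rightarrow> ('a \<times> 'a) pmf) \<Rightarrow> mask \<Rightarrow> (nat \<times> party \<Rightarrow> 'a \<times> 'a) \<Rightarrow> real" where
  "logletter M P K v = (\<Sum>b\<in>links M. log 2 (pmf (map_pmf (sel K b) (case_prod P b)) (sel K b (v b))))"

lemma mview_eq_iff:
  "mview M n K \<omega> = mview M n K \<omega>' \<longleftrightarrow>
    (\<forall>t<n. \<forall>b\<in>links M. sel K b (\<omega> t b) = sel K b (\<omega>' t b))"
  unfolding mview_def fun_eq_iff by (auto split: if_splits)

lemma sel_eq_iff:
  "sel K b x = sel K b y \<longleftrightarrow> ((b, False) \<in> K \<longrightarrow> fst x = fst y) \<and> ((b, True) \<in> K \<longrightarrow> snd x = snd y)"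
  unfolding sel_def fun_eq_iff by (auto simp: all_bool_eq)

lemma mview_mono: "K \<subseteq> K' \<Longrightarrow> mview M n K' \<omega> = mview M n K' \<omega>' \<Longrightarrow> mview M n K \<omega> = mview M n K \<omega>'"
  unfolding mview_eq_iff sel_eq_iff by blast

lemma mview_Un: "mview M n (K \<union> K') \<omega> = mview M n (K \<union> K') \<omega>' \<longleftrightarrow>
   mview M n K \<omega> = mview M n K \<omega>' \<and> mview M n K' \<omega> = mview M n K' \<omega>'"
  unfolding mview_eq_iff sel_eq_iff by blast

context
  fixes M :: nat and P :: "nat \<Rightarrow> party \<Rightarrow> ('a::finite \<times> 'a) pmf"
begin

lemma pin_source_links:
  "pin_source M n P = Pi_pmf {..<n} undefined (\<lambda>_. Pi_pmf (links M) undefined (case_prod P))"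
  by (simp add: pin_source_def links_def)

lemma finite_set_pmf_letter: "finite (set_pmf (Pi_pmf (links M) d (case_prod P)))"
  by (simp add: set_Pi_pmf finite_PiE_dflt)

lemma finite_set_pin_source: "finite (set_pmf (pin_source M n P))"
  unfolding pin_source_links by (simp add: set_Pi_pmf finite_PiE_dflt)

lemma pin_source_support:
  assumes "\<omega> \<in> set_pmf (pin_source M n P)" "t < n" "b \<in> links M"
  shows "\<omega> t b \<in> set_pmf (case_prod P b)"
proof -
  have "\<omega> t \<in> set_pmf (Pi_pmf (links M) undefined (case_prod P))"
    using assms(1,2) unfolding pin_source_links by (auto simp: set_Pi_pmf PiE_dflt_def)
  then show ?thesis using assms(3) by (simp add: set_Pi_pmf PiE_dflt_def del: split_paired_All)
qed

lemma pmf_mview: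
  "pmf (map_pmf (mview M n K) (pin_source M n P)) (mview M n K \<omega>)
    = (\<Prod>t<n. \<Prod>b\<in>links M. pmf (map_pmf (sel K b) (case_prod P b)) (sel K b (\<omega> t b)))"
proof -
  have "pmf (map_pmf (mview M n K) (pin_source M n P)) (mview M n K \<omega>)
      = measure_pmf.prob (pin_source M n P)
         (Pi {..<n} (\<lambda>t. Pi (links M) (\<lambda>b. {x. sel K b x = sel K b (\<omega> t b)})))"
    unfolding pmf_map by (rule arg_cong[where f="measure_pmf.prob _"]) (auto simp: mview_eq_iff Pi_def)
  also have "\<dots> = (\<Prod>t<n. \<Prod>b\<in>links M. measure_pmf.prob (case_prod P b) {x. sel K b x = sel K b (\<omega> t b)})"
    unfolding pin_source_links by (simp add: measure_Pi_pmf_Pi)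
  also have "\<dots> = (\<Prod>t<n. \<Prod>b\<in>links M. pmf (map_pmf (sel K b) (case_prod P b)) (sel K b (\<omega> t b)))"
    unfolding pmf_map by (intro prod.cong refl arg_cong[where f="measure_pmf.prob _"]) auto
  finally show ?thesis .
qed

lemma log_pmf_mview:
  assumes "\<omega> \<in> set_pmf (pin_source M n P)"
  shows "log 2 (pmf (map_pmf (mview M n K) (pin_source M n P)) (mview M n K \<omega>))
    = (\<Sum>t<n. logletter M P K (\<omega> t))"
proof -
  have pos: "pmf (map_pmf (sel K b) (case_prod P b)) (sel K b (\<omega> t b)) > 0"
    if "t < n" "b \<in> links M" for t b
    using pmf_map_pos[OF pin_source_support[OF assms that]] .
  have ne: "0 < (\<Prod>b\<in>links M. pmf (map_pmf (sel K b) (case_prod P b)) (sel K b (\<omega> t b)))"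
    if "t < n" for t
    using pos[OF that] by (intro prod_pos) blast
  have ne': "\<And>t. t \<in> {..<n} \<Longrightarrow> (\<Prod>b\<in>links M. pmf (map_pmf (sel K b) (case_prod P b)) (sel K b (\<omega> t b))) \<noteq> 0"
    using less_imp_neq[OF ne, symmetric] by (simp only: lessThan_iff not_False_eq_True)
  have "log 2 (pmf (map_pmf (mview M n K) (pin_source M n P)) (mview M n K \<omega>))
     = (\<Sum>t<n. log 2 (\<Prod>b\<in>links M. pmf (map_pmf (sel K b) (case_prod P b)) (sel K b (\<omega> t b))))"
    unfolding pmf_mview log_def by (subst ln_prod[OF finite_lessThan ne']) (simp_all add: sum_divide_distrib)
  also have "\<dots> = (\<Sum>t<n. logletter M P K (\<omega> t))"
    unfolding logletter_def log_def
    by (intro sum.cong refl, subst ln_prod) (simp_all add: sum_divide_distrib less_imp_neq[OF pos, symmetric])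
  finally show ?thesis .
qed

lemma expectation_logletter:
  "measure_pmf.expectation (Pi_pmf (links M) d (case_prod P)) (logletter M P K) = - mask_ent M P K"
proof -
  have "measure_pmf.expectation (Pi_pmf (links M) d (case_prod P)) (logletter M P K)
    = (\<Sum>b\<in>links M. measure_pmf.expectation (Pi_pmf (links M) d (case_prod P))
        (\<lambda>v. log 2 (pmf (map_pmf (sel K b) (case_prod P b)) (sel K b (v b)))))"
    unfolding logletter_def
    by (intro Bochner_Integration.integral_sum integrable_measure_pmf_finite finite_set_pmf_letter)
  also have "\<dots> = (\<Sum>b\<in>links M. - ent (case_prod P b) (sel K b))"
    by (intro sum.cong refl, subst expectation_Pi_pmf_component) (auto simp: ent_eq_expectation)
  finally show ?thesis by (simp add: mask_ent_def sum_negf)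
qed

lemma ent_mview: "ent (pin_source M n P) (mview M n K) = real n * mask_ent M P K"
proof -
  have "ent (pin_source M n P) (mview M n K)
    = - measure_pmf.expectation (pin_source M n P) (\<lambda>\<omega>. \<Sum>t<n. logletter M P K (\<omega> t))"
    unfolding ent_eq_expectation[OF finite_set_pin_source]
    by (intro arg_cong[where f=uminus] integral_cong_AE) (auto simp: AE_measure_pmf_iff log_pmf_mview)
  also have "\<dots> = - (\<Sum>t<n. measure_pmf.expectation (pin_source M n P) (\<lambda>\<omega>. logletter M P K (\<omega> t)))"
    by (intro arg_cong[where f=uminus] Bochner_Integration.integral_sum integrable_measure_pmf_finite
        finite_set_pin_source)
  also have "\<dots> = - (\<Sum>t<n. - mask_ent M P K)"
    unfolding pin_source_links
    by (simp add: expectation_Pi_pmf_component expectation_logletter)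
  finally show ?thesis by simp
qed

lemma mview_aep:
  assumes "\<delta> > 0" "e > 0"
  shows "\<forall>\<^sub>F n in sequentially. measure_pmf.prob (pin_source M n P)
     {\<omega>. \<bar>log 2 (pmf (map_pmf (mview M n K) (pin_source M n P)) (mview M n K \<omega>))
         + real n * mask_ent M P K\<bar> \<ge> real n * \<delta>} \<le> e"
  using Pi_pmf_weak_law[OF finite_set_pmf_letter assms, of undefined undefined "logletter M P K"]
proof eventually_elim
  case (elim n)
  have "measure_pmf.prob (pin_source M n P)
     {\<omega>. \<bar>log 2 (pmf (map_pmf (mview M n K) (pin_source M n P)) (mview M n K \<omega>))
         + real n * mask_ent M P K\<bar> \<ge> real n * \<delta>}
    \<le> measure_pmf.prob (pin_source M n P)
     {\<omega>. \<bar>(\<Sum>t<n. logletter M P K (\<omega> t)) + real n * mask_ent M P K\<bar> \<ge> real n * \<delta>}"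
    by (rule measure_pmf.finite_measure_mono_AE) (auto simp: AE_measure_pmf_iff log_pmf_mview)
  also have "\<dots> \<le> e"
    using elim by (simp add: pin_source_links expectation_logletter)
  finally show ?case .
qed

end

definition tmask :: "terminal \<Rightarrow> mask" where
  "tmask \<tau> = (case \<tau> of Alice \<Rightarrow> {((i, PA), False) |i. True} | Bob \<Rightarrow> {((i, PB), False) |i. True}
     | Relay m \<Rightarrow> {((m, PA), True), ((m, PB), True)})"

text \<open>Both views separate the same samples, so they have the same entropies and fibre
  probabilities, and all estimates can be made on masks.\<close>

lemma terminal_view_eq_iff:
  "terminal_view M n \<tau> \<omega> = terminal_view M n \<tau> \<omega>' \<longleftrightarrow>
    mview M n (tmask \<tau>) \<omega> = mview M n (tmask \<tau>) \<omega>'"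
proof -
  have all_party: "(\<forall>\<alpha>. Q \<alpha>) \<longleftrightarrow> Q PA \<and> Q PB" for Q by (metis party.exhaust)
  show ?thesis
    unfolding mview_eq_iff sel_eq_iff
    by (cases \<tau>) (auto simp: terminal_view_def fun_eq_iff tmask_def links_def all_party split: if_splits)
qed

section \<open>Converse\<close>

lemma ent_sel:
  assumes "finite (set_pmf p)"
  shows "ent p (sel K b) = (if (b, False) \<in> K
      then if (b, True) \<in> K then ent p (\<lambda>x. (fst x, snd x)) else ent p fst
      else if (b, True) \<in> K then ent p snd else 0)"
proof -
  have "ent p (sel K b) = ent p (\<lambda>_. ())" if "(b, False) \<notin> K" "(b, True) \<notin> K"
    by (rule ent_cong[OF assms]) (use that in \<open>simp add: sel_eq_iff\<close>)
  moreover have "ent p (\<lambda>_. ()) = 0" by (simp add: ent_def pmf_map)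
  moreover have "ent p (sel K b) = ent p snd" if "(b, False) \<notin> K" "(b, True) \<in> K"
    by (rule ent_cong[OF assms]) (use that in \<open>simp add: sel_eq_iff\<close>)
  moreover have "ent p (sel K b) = ent p fst" if "(b, False) \<in> K" "(b, True) \<notin> K"
    by (rule ent_cong[OF assms]) (use that in \<open>simp add: sel_eq_iff\<close>)
  moreover have "ent p (sel K b) = ent p (\<lambda>x. (fst x, snd x))" if "(b, False) \<in> K" "(b, True) \<in> K"
    by (rule ent_cong[OF assms]) (use that in \<open>simp add: sel_eq_iff prod_eq_iff\<close>)
  ultimately show ?thesis by simp
qed

lemma outcome_0: "outcome M n P 0 \<phi> = map_pmf (\<lambda>\<omega>. (\<omega>, [])) (pin_source M n P)"
  by (simp add: outcome_def map_pmf_def bind_return_pmf)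

lemma outcome_Suc:
  "outcome M n P (Suc l) \<phi> = map_pmf (\<lambda>((\<omega>, fs), f). (\<omega>, fs @ [f]))
     (bind_pmf (outcome M n P l \<phi>) (\<lambda>s. map_pmf (Pair s)
        (\<phi> (Suc l) (terminal_view M n (transmitter M (Suc l)) (fst s)) (snd s))))"
  by (simp add: outcome_def map_bind_pmf bind_map_pmf bind_assoc_pmf pmf.map_comp o_def)

text \<open>\<open>h l K\<close> is the joint entropy of the view \<open>K\<close> and the first
  \<open>l\<close> messages, so its increment is the conditional entropy of the next message. It
  decreases as the view grows, and it is one constant for all views that contain the sender's,
  because the message then depends on nothing else but private randomness.\<close>

lemma outcome_step:
  fixes h :: "nat \<Rightarrow> mask \<Rightarrow> real" and P :: "nat \<Rightarrow> party \<Rightarrow> ('a \<times> 'a) pmf"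
  assumes fin: "\<And>l x fs. finite (set_pmf (\<phi> l x fs))" "finite (set_pmf (pin_source M n P))"
  defines "h \<equiv> \<lambda>l K. ent (outcome M n P l \<phi>) (\<lambda>(\<omega>, fs). (mview M n K \<omega>, fs))"
  shows "finite (set_pmf (outcome M n P l \<phi>))"
    and "K \<subseteq> K' \<Longrightarrow> h (Suc l) K' - h l K' \<le> h (Suc l) K - h l K"
    and "\<exists>c. \<forall>K. tmask (transmitter M (Suc l)) \<subseteq> K \<longrightarrow> h (Suc l) K = h l K + c"
proof -
  show fin_out: "finite (set_pmf (outcome M n P l \<phi>))" for l
    by (induction l) (auto simp: outcome_0 outcome_Suc fin)
  let ?\<kappa> = "\<lambda>s. \<phi> (Suc l) (terminal_view M n (transmitter M (Suc l)) (fst s)) (snd s)"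
  \<comment> \<open>The new message is kept apart from the transcript, so that both
    \<open>h l\<close> and \<open>h (Suc l)\<close> are entropies on the same space.\<close>
  let ?p' = "bind_pmf (outcome M n P l \<phi>) (\<lambda>s. map_pmf (Pair s) (?\<kappa> s))"
  have fin': "finite (set_pmf ?p')" using fin_out fin by auto
  have hl: "h l K = ent ?p' (\<lambda>x. (mview M n K (fst (fst x)), snd (fst x)))" for K
  proof -
    have "map_pmf fst ?p' = outcome M n P l \<phi>"
      by (simp add: map_bind_pmf pmf.map_comp o_def map_pmf_const bind_return_pmf')
    then show ?thesis
      using ent_map_pmf[OF fin', of fst "\<lambda>(\<omega>, fs). (mview M n K \<omega>, fs)"]
      by (simp add: h_def o_def case_prod_unfold)
  qed
  have hSl: "h (Suc l) K = ent ?p' (\<lambda>x. (snd x, mview M n K (fst (fst x)), snd (fst x)))" for K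
    unfolding h_def outcome_Suc ent_map_pmf[OF fin']
    by (rule ent_cong[OF fin']) auto
  show "h (Suc l) K' - h l K' \<le> h (Suc l) K - h l K" if "K \<subseteq> K'"
    unfolding hSl hl
    by (rule ent_cond_antimono[OF fin'], unfold prod.inject, elim conjE, intro conjI)
      (erule mview_mono[OF that], assumption)
  show "\<exists>c. \<forall>K. tmask (transmitter M (Suc l)) \<subseteq> K \<longrightarrow> h (Suc l) K = h l K + c"
  proof (intro exI allI impI)
    fix K :: mask assume K: "tmask (transmitter M (Suc l)) \<subseteq> K"
    let ?R = "\<lambda>(\<omega>, fs). (mview M n K \<omega>, fs)"
    have "ent ?p' (\<lambda>(s, f). (?R s, f))
       = ent (outcome M n P l \<phi>) ?R - (\<Sum>(s, f)\<in>set_pmf ?p'. pmf ?p' (s, f) * log 2 (pmf (?\<kappa> s) f))"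
    proof (rule ent_kernel[OF fin_out fin(1)])
      fix s s' :: "'a sample \<times> nat list" assume "?R s = ?R s'"
      then have "mview M n K (fst s) = mview M n K (fst s')" "snd s = snd s'"
        by (auto simp: case_prod_unfold)
      then show "?\<kappa> s = ?\<kappa> s'"
        using mview_mono[OF K, of M n "fst s" "fst s'"] by (simp add: terminal_view_eq_iff[symmetric])
    qed
    moreover have "h (Suc l) K = ent ?p' (\<lambda>(s, f). (?R s, f))"
      unfolding hSl by (rule ent_cong[OF fin']) auto
    ultimately show "h (Suc l) K = h l K +
       - (\<Sum>(s, f)\<in>set_pmf ?p'. pmf ?p' (s, f) * log 2 (pmf (?\<kappa> s) f))"
      by (simp add: h_def)
  qed
qed

lemma transmitter_cases:
  assumes "M \<ge> 1"
  obtains "transmitter M l = Alice" | "transmitter M l = Bob"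
  | i where "i \<in> {1..M}" "transmitter M l = Relay i"
proof -
  have "l mod (M + 2) < M + 2" by (rule mod_less_divisor) simp
  then have "l mod (M + 2) = M + 1 \<or> l mod (M + 2) = 0 \<or> l mod (M + 2) \<in> {1..M}"
    unfolding atLeastAtMost_iff by linarith
  then show ?thesis using that by (auto simp: transmitter_def)
qed

text \<open>Per link this is a conditional mutual information. It vanishes for the links of
  \<open>m\<close>, whose relay ends are conditioned on, and for links with both ends on one side.
  Each other relay has one severed link: on Bob's side the one to Alice, otherwise the one to Bob,
  by choice of \<open>bobside\<close> the weaker of the two.\<close>

lemma cut_rate:
  fixes P :: "nat \<Rightarrow> party \<Rightarrow> ('a::finite \<times> 'a) pmf" and M m :: nat
  assumes m: "m \<in> {1..M}"
    and bobside: "\<And>i. bobside i \<longleftrightarrow> mutual_info_pmf (P i PA) fst snd \<le> mutual_info_pmf (P i PB) fst snd"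
  defines "U \<equiv> tmask Alice \<union> {((i, \<alpha>), True) |i \<alpha>. i \<noteq> m \<and> \<not> bobside i}"
    and "V \<equiv> tmask Bob \<union> {((i, \<alpha>), True) |i \<alpha>. i \<noteq> m \<and> bobside i}"
    and "Z \<equiv> tmask (Relay m)"
  shows "mask_ent M P (U \<union> Z) + mask_ent M P (V \<union> Z) - mask_ent M P (U \<union> V \<union> Z) - mask_ent M P Z
     = (\<Sum>i\<in>{1..M} - {m}. pin_rate P i)"
proof -
  define d where "d b = ent (case_prod P b) (sel (U \<union> Z) b) + ent (case_prod P b) (sel (V \<union> Z) b)
     - ent (case_prod P b) (sel (U \<union> V \<union> Z) b) - ent (case_prod P b) (sel Z b)" for b
  have d: "d (i, PA) + d (i, PB) = (if i = m then 0 else pin_rate P i)" for i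
  proof -
    have r: "pin_rate P i = (if bobside i then mutual_info_pmf (P i PA) fst snd
        else mutual_info_pmf (P i PB) fst snd)"
      by (simp add: pin_rate_def bobside min_def)
    show ?thesis unfolding d_def r
      by (cases "i = m"; cases "bobside i")
        (simp_all add: ent_sel U_def V_def Z_def tmask_def mutual_info_eq_ent)
  qed
  have "mask_ent M P (U \<union> Z) + mask_ent M P (V \<union> Z) - mask_ent M P (U \<union> V \<union> Z) - mask_ent M P Z
     = (\<Sum>b\<in>{1..M} \<times> {PA, PB}. d b)"
    by (simp add: mask_ent_def links_def d_def sum.distrib sum_subtractf)
  also have "\<dots> = (\<Sum>i\<in>{1..M}. \<Sum>\<alpha>\<in>{PA, PB}. d (i, \<alpha>))"
    by (simp only: sum.cartesian_product case_prod_eta)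
  also have "\<dots> = (\<Sum>i\<in>{1..M}. if i = m then 0 else pin_rate P i)"
    using d by simp
  also have "\<dots> = (\<Sum>i\<in>{1..M} - {m}. pin_rate P i)"
    using m by (subst sum.remove[of _ m]) (auto intro: sum.cong)
  finally show ?thesis .
qed

text \<open>Alice's key is a function of her side. Given \<open>Z\<close> and the transcript, the
  mutual information of the two sides is therefore at least the key's conditional entropy minus what
  remains of it given Bob's side. The former is entropy minus leakage, the latter is bounded by
  Fano's inequality.\<close>

lemma cut_bound:
  fixes P :: "nat \<Rightarrow> party \<Rightarrow> ('a::finite \<times> 'a) pmf" and M m n q :: nat
    and KA KB :: "'a view \<Rightarrow> nat list \<Rightarrow> nat"
  assumes m: "m \<in> {1..M}" and fin: "\<And>l x fs. finite (set_pmf (\<phi> l x fs))"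
    and K: "finite K" "\<And>x fs. KA x fs \<in> K" and e: "0 < e" "e < 1"
  defines "\<Omega> \<equiv> outcome M n P q \<phi>"
  defines "keyA \<equiv> \<lambda>(\<omega>, fs). KA (terminal_view M n Alice \<omega>) fs"
    and "keyB \<equiv> \<lambda>(\<omega>, fs). KB (terminal_view M n Bob \<omega>) fs"
  assumes err: "measure_pmf.prob \<Omega> {w. keyA w \<noteq> keyB w} \<le> e"
  shows "ent \<Omega> keyA \<le> mutual_info_pmf \<Omega> keyA (\<lambda>(\<omega>, fs). (terminal_view M n (Relay m) \<omega>, fs))
     + real n * (\<Sum>i\<in>{1..M} - {m}. pin_rate P i)
     + (e * log 2 (card K) - log 2 (1 - e) - e * log 2 e)"
proof -
  define bobside where
    "bobside = (\<lambda>i. mutual_info_pmf (P i PA) fst snd \<le> mutual_info_pmf (P i PB) fst snd)"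
  define U where "U = tmask Alice \<union> {((i, \<alpha>), True) |i \<alpha>. i \<noteq> m \<and> \<not> bobside i}"
  define V where "V = tmask Bob \<union> {((i, \<alpha>), True) |i \<alpha>. i \<noteq> m \<and> bobside i}"
  define Z where "Z = tmask (Relay m)"
  define W where "W = (\<lambda>K (\<omega> :: 'a sample, fs :: nat list). (mview M n K \<omega>, fs))"
  have W: "W K = (\<lambda>(\<omega>, fs). (mview M n K \<omega>, fs))" for K by (simp add: W_def)
  define h where "h = (\<lambda>l K. ent (outcome M n P l \<phi>) (W K))"
  \<comment> \<open>The mutual information of the sides \<open>U\<close> and \<open>V\<close> given
    \<open>Z\<close> and the first \<open>l\<close> messages.\<close>
  define J where "J = (\<lambda>l. h l (U \<union> Z) + h l (V \<union> Z) - h l (U \<union> V \<union> Z) - h l Z)"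
  have h: "h l K = ent (outcome M n P l \<phi>) (W K)" for l K by (simp add: h_def)
  note step = outcome_step[where \<phi>=\<phi> and M=M and n=n and P=P, OF fin finite_set_pin_source, folded W, folded h]
  have J_step: "J (Suc l) \<le> J l" for l
  proof -
    let ?t = "tmask (transmitter M (Suc l))"
    obtain c where c: "?t \<subseteq> K \<Longrightarrow> h (Suc l) K = h l K + c" for K
      using step(3) by blast
    have mono: "h (Suc l) (U \<union> Z) - h l (U \<union> Z) \<le> h (Suc l) Z - h l Z"
      "h (Suc l) (V \<union> Z) - h l (V \<union> Z) \<le> h (Suc l) Z - h l Z"
      by (rule step(2); blast)+
    have "M \<ge> 1" using m by simp
    \<comment> \<open>Every relay other than \<open>m\<close> is on exactly one side, and
      \<open>m\<close> is on both because its view is \<open>Z\<close>.\<close>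
    then have "?t \<subseteq> U \<union> Z \<or> ?t \<subseteq> V \<union> Z"
      by (cases rule: transmitter_cases[where l="Suc l"]) (auto simp: U_def V_def Z_def tmask_def)
    then show ?thesis
    proof
      assume t: "?t \<subseteq> U \<union> Z"
      then have "?t \<subseteq> U \<union> V \<union> Z" by blast
      then show ?thesis using c[OF t] c[of "U \<union> V \<union> Z"] mono by (simp add: J_def)
    next
      assume t: "?t \<subseteq> V \<union> Z"
      then have "?t \<subseteq> U \<union> V \<union> Z" by blast
      then show ?thesis using c[OF t] c[of "U \<union> V \<union> Z"] mono by (simp add: J_def)
    qed
  qed
  have J_le: "J l \<le> J 0" for l
  proof (induction l)
    case (Suc l)
    then show ?case using J_step[of l] by linarith
  qed simp
  have h0: "h 0 K = real n * mask_ent M P K" for K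
  proof -
    have "h 0 K = ent (pin_source M n P) (W K \<circ> (\<lambda>\<omega>. (\<omega>, [])))"
      unfolding h_def outcome_0 by (rule ent_map_pmf[OF finite_set_pin_source])
    also have "\<dots> = ent (pin_source M n P) (mview M n K)"
      by (rule ent_cong[OF finite_set_pin_source]) (simp add: W_def)
    finally show ?thesis by (simp add: ent_mview)
  qed
  have J0: "J 0 = real n * (\<Sum>i\<in>{1..M} - {m}. pin_rate P i)"
  proof -
    have c: "mask_ent M P (U \<union> Z) + mask_ent M P (V \<union> Z) - mask_ent M P (U \<union> V \<union> Z) - mask_ent M P Z
      = (\<Sum>i\<in>{1..M} - {m}. pin_rate P i)"
      unfolding U_def V_def Z_def by (rule cut_rate[OF m]) (simp add: bobside_def)
    show ?thesis unfolding c[symmetric] J_def h0 by (simp add: algebra_simps)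
  qed
  have fin\<Omega>: "finite (set_pmf \<Omega>)" unfolding \<Omega>_def by (rule step(1))
  have hq: "h q K = ent \<Omega> (W K)" for K by (simp add: h_def \<Omega>_def)
  have subU: "tmask Alice \<subseteq> U \<union> Z" and subV: "tmask Bob \<subseteq> V \<union> Z"
    unfolding U_def V_def by blast+
  have keyA: "keyA w = keyA w'" if "W (U \<union> Z) w = W (U \<union> Z) w'" for w w'
    using that mview_mono[OF subU, of M n "fst w" "fst w'"]
    by (auto simp: W_def keyA_def case_prod_unfold simp flip: terminal_view_eq_iff)
  have keyB: "keyB w = keyB w'" if "W (V \<union> Z) w = W (V \<union> Z) w'" for w w'
    using that mview_mono[OF subV, of M n "fst w" "fst w'"]
    by (auto simp: W_def keyB_def case_prod_unfold simp flip: terminal_view_eq_iff)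
  have WUn: "W (A \<union> B) w = W (A \<union> B) w' \<longleftrightarrow> W A w = W A w' \<and> W B w = W B w'" for A B w w'
    by (auto simp: W_def case_prod_unfold mview_Un)
  have "ent \<Omega> (\<lambda>w. (W (U \<union> Z) w, W (V \<union> Z) w, (keyA w, W Z w))) + ent \<Omega> (\<lambda>w. (keyA w, W Z w))
     \<le> ent \<Omega> (\<lambda>w. (W (U \<union> Z) w, (keyA w, W Z w))) + ent \<Omega> (\<lambda>w. (W (V \<union> Z) w, (keyA w, W Z w)))"
    by (rule ent_submodular[OF fin\<Omega>])
  moreover have "ent \<Omega> (\<lambda>w. (W (U \<union> Z) w, W (V \<union> Z) w, (keyA w, W Z w))) = h q (U \<union> V \<union> Z)"
    unfolding hq by (rule ent_cong[OF fin\<Omega>], unfold prod.inject WUn, insert keyA[unfolded WUn], blast)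
  moreover have "ent \<Omega> (\<lambda>w. (W (U \<union> Z) w, (keyA w, W Z w))) = h q (U \<union> Z)"
    unfolding hq by (rule ent_cong[OF fin\<Omega>], unfold prod.inject WUn, insert keyA[unfolded WUn], blast)
  moreover have "ent \<Omega> (\<lambda>w. (W (V \<union> Z) w, (keyA w, W Z w))) = ent \<Omega> (\<lambda>w. (keyA w, W (V \<union> Z) w))"
    by (rule ent_cong[OF fin\<Omega>]) (auto simp: WUn)
  moreover have "ent \<Omega> (\<lambda>w. (keyA w, W (V \<union> Z) w)) - h q (V \<union> Z) \<le> ent \<Omega> (\<lambda>w. (keyA w, keyB w)) - ent \<Omega> keyB"
    unfolding hq by (rule ent_cond_antimono[OF fin\<Omega>]) (use keyB in blast)
  moreover have "ent \<Omega> (\<lambda>w. (keyA w, keyB w)) - ent \<Omega> keyB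
      \<le> e * log 2 (card K) - log 2 (1 - e) - e * log 2 e"
    by (rule fano[OF fin\<Omega> K(1) _ e err]) (use K(2) in \<open>auto simp: keyA_def\<close>)
  moreover have "mutual_info_pmf \<Omega> keyA (\<lambda>(\<omega>, fs). (terminal_view M n (Relay m) \<omega>, fs))
     = ent \<Omega> keyA + h q Z - ent \<Omega> (\<lambda>w. (keyA w, W Z w))"
  proof -
    have "ent \<Omega> (\<lambda>(\<omega>, fs). (terminal_view M n (Relay m) \<omega>, fs)) = h q Z"
      "ent \<Omega> (\<lambda>w. (keyA w, case w of (\<omega>, fs) \<Rightarrow> (terminal_view M n (Relay m) \<omega>, fs)))
       = ent \<Omega> (\<lambda>w. (keyA w, W Z w))"
      unfolding hq by (rule ent_cong[OF fin\<Omega>]; auto simp: W_def Z_def terminal_view_eq_iff)+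
    then show ?thesis by (simp add: mutual_info_eq_ent[OF fin\<Omega>])
  qed
  ultimately show ?thesis using J_le[of q] J0 by (simp add: J_def)
qed

lemma achievable_le_cut:
  fixes P :: "nat \<Rightarrow> party \<Rightarrow> ('a::finite \<times> 'a) pmf"
  assumes ach: "achievable M P R" and m: "m \<in> {1..M}"
  shows "R \<le> (\<Sum>i\<in>{1..M} - {m}. pin_rate P i)"
proof -
  let ?C = "\<Sum>i\<in>{1..M} - {m}. pin_rate P i"
  \<comment> \<open>The block length depends on \<open>e\<close> without control, so it has to be
    eliminated before \<open>e\<close> tends to 0.\<close>
  have main: "(R - e) * (1 - e) \<le> e + ?C + e * e - log 2 (1 - e) - e * log 2 e"
    if e: "0 < e" "e < 1" for e
    using ach[unfolded achievable_def, rule_format, OF e(1)]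
  proof (elim exE, goal_cases)
    case (1 n q \<phi> KA KB K L)
    note * = 1[unfolded Let_def]
    have n: "n > 0" and K: "finite K" "\<And>x fs. KA x fs \<in> K"
      and L: "\<And>l x fs. set_pmf (\<phi> l x fs) \<subseteq> {..<L}"
      using * by auto
    have err: "measure_pmf.prob (outcome M n P q \<phi>) {w. (\<lambda>(\<omega>, fs). KA (terminal_view M n Alice \<omega>) fs) w
          \<noteq> (\<lambda>(\<omega>, fs). KB (terminal_view M n Bob \<omega>) fs) w} \<le> e"
      using * by (elim conjE)
    have r1: "entropy_pmf (map_pmf (\<lambda>(\<omega>, fs). KA (terminal_view M n Alice \<omega>) fs) (outcome M n P q \<phi>)) / real n \<ge> R - e"
      using * by (elim conjE)
    have r2: "entropy_pmf (map_pmf (\<lambda>(\<omega>, fs). KA (terminal_view M n Alice \<omega>) fs) (outcome M n P q \<phi>)) / real n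
         \<ge> log 2 (real (card K)) / real n - e"
      using * by (elim conjE)
    have sec: "\<forall>m\<in>{1..M}. mutual_info_pmf (outcome M n P q \<phi>) (\<lambda>(\<omega>, fs). KA (terminal_view M n Alice \<omega>) fs)
                 (\<lambda>(\<omega>, fs). (terminal_view M n (Relay m) \<omega>, fs)) / real n \<le> e"
      using * by (elim conjE)
    have fin: "finite (set_pmf (\<phi> l x fs))" for l x fs
      using finite_subset[OF L] by simp
    let ?H = "ent (outcome M n P q \<phi>) (\<lambda>(\<omega>, fs). KA (terminal_view M n Alice \<omega>) fs)"
    have H: "entropy_pmf (map_pmf (\<lambda>(\<omega>, fs). KA (terminal_view M n Alice \<omega>) fs) (outcome M n P q \<phi>)) = ?H"
      using outcome_step(1)[of \<phi>, OF fin finite_set_pin_source] by (simp add: ent_eq_entropy_pmf)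
    have c: "0 \<le> - log 2 (1 - e) - e * log 2 e"
    proof -
      have "e * log 2 e \<le> 0" using e by (simp add: mult_nonneg_nonpos)
      moreover have "log 2 (1 - e) \<le> 0" using e by simp
      ultimately show ?thesis by linarith
    qed
    have "?H \<le> real n * e + real n * ?C + (e * log 2 (card K) - log 2 (1 - e) - e * log 2 e)"
      using cut_bound[where \<phi>=\<phi> and KB=KB, OF m fin K e err] bspec[OF sec m] n by (simp add: field_simps)
    \<comment> \<open>Near-uniformity controls the key alphabet: Fano's term becomes
      \<open>e\<close> times the key entropy itself, which is absorbed on the left as the factor
      \<open>1 - e\<close>.\<close>
    moreover have "log 2 (card K) \<le> ?H + real n * e"
    proof -
      have "log 2 (card K) / real n \<le> (?H + real n * e) / real n"
        using r2 n unfolding H by (simp add: add_divide_distrib)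
      then show ?thesis using n by (simp add: divide_le_cancel)
    qed
    then have "e * log 2 (card K) \<le> e * (?H + real n * e)" using e by (intro mult_left_mono) auto
    ultimately have "?H * (1 - e) \<le> real n * (e + ?C + e * e) + (- log 2 (1 - e) - e * log 2 e)"
      by (simp add: algebra_simps)
    also have "\<dots> \<le> real n * (e + ?C + e * e) + real n * (- log 2 (1 - e) - e * log 2 e)"
      using mult_right_mono[OF _ c, of 1 "real n"] n by simp
    finally have "?H * (1 - e) \<le> real n * (e + ?C + e * e - log 2 (1 - e) - e * log 2 e)"
      by (simp add: algebra_simps)
    then have "?H / real n * (1 - e) \<le> e + ?C + e * e - log 2 (1 - e) - e * log 2 e"
      using n by (simp add: field_simps)
    moreover have "(R - e) * (1 - e) \<le> ?H / real n * (1 - e)"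
      using r1 e unfolding H by (intro mult_right_mono) auto
    ultimately show ?thesis by linarith
  qed
  have "((\<lambda>e. (R - e) * (1 - e)) \<longlongrightarrow> R) (at_right 0)"
    by real_asymp
  moreover have "((\<lambda>e. e + ?C + e * e - log 2 (1 - e) - e * log 2 e) \<longlongrightarrow> ?C) (at_right 0)"
  proof -
    have "((\<lambda>e. e + C + e * e - ln (1 - e) / ln 2 - e * (ln e / ln 2)) \<longlongrightarrow> C) (at_right 0)" for C :: real
      by real_asymp
    then show ?thesis unfolding log_def .
  qed
  moreover have "\<forall>\<^sub>F e in at_right 0. (R - e) * (1 - e) \<le> e + ?C + e * e - log 2 (1 - e) - e * log 2 e"
    using eventually_at_right_real[OF zero_less_one] by (rule eventually_mono) (rule main; simp)
  ultimately show ?thesis by (intro tendsto_le[OF trivial_limit_at_right_real])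
qed

section \<open>Random binning and privacy amplification\<close>

text \<open>All functions from \<open>A\<close> to \<open>{..<L}\<close>, set to 0 outside
  \<open>A\<close> to make the family finite. A function with \<open>f x = f x'\<close> is
  determined by its values away from \<open>x\<close>, which leaves one \<open>L\<close>-th of the
  family. Sums over \<open>H\<close> play the role of a random choice.\<close>

lemma universal_hash_family:
  fixes A :: "'x set" and L :: nat
  assumes A: "finite A" and L: "L > 0"
  obtains H :: "('x \<Rightarrow> nat) set" where "finite H" "H \<noteq> {}" "\<And>f x. f \<in> H \<Longrightarrow> f x < L"
    "\<And>x x'. x \<in> A \<Longrightarrow> x' \<in> A \<Longrightarrow> x \<noteq> x' \<Longrightarrow> real (card {f \<in> H. f x = f x'}) \<le> real (card H) / real L"
proof
  let ?H = "PiE_dflt A 0 (\<lambda>_. {..<L})"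
  show fin: "finite ?H" using A by (intro finite_PiE_dflt) auto
  show "?H \<noteq> {}" using L by (auto simp: PiE_dflt_empty_iff)
  show "f x < L" if "f \<in> ?H" for f x using that L by (cases "x \<in> A") (auto simp: PiE_dflt_def)
  fix x x' assume x: "x \<in> A" "x' \<in> A" "x \<noteq> x'"
  let ?E = "{f \<in> ?H. f x = f x'}"
  have "inj_on (\<lambda>f. f(x := 0)) ?E"
  proof (rule inj_onI)
    fix f g assume fg: "f \<in> ?E" "g \<in> ?E" "f(x := 0) = g(x := 0)"
    then have eq: "f y = g y" if "y \<noteq> x" for y using that by (metis fun_upd_other)
    have "f x = g x" using eq[of x'] fg x by auto
    then show "f = g" using eq by (metis ext)
  qed
  moreover have "(\<lambda>f. f(x := 0)) ` ?E \<subseteq> PiE_dflt (A - {x}) 0 (\<lambda>_. {..<L})"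
    by (auto simp: PiE_dflt_def)
  ultimately have "card ?E \<le> card (PiE_dflt (A - {x}) 0 (\<lambda>_. {..<L}))"
    using A by (intro card_inj_on_le) auto
  also have "\<dots> = L ^ (card A - 1)" using A x by (subst card_PiE_dflt) auto
  finally have "card ?E * L \<le> L ^ (card A - 1) * L" by simp
  also have "\<dots> = card ?H"
    using A x by (subst card_PiE_dflt) (auto simp: power_eq_if mult.commute)
  finally have "real (card ?E * L) \<le> real (card ?H)" by (subst of_nat_le_iff)
  then have "real (card ?E) * real L \<le> real (card ?H)" by (subst (asm) of_nat_mult)
  then show "real (card ?E) \<le> real (card ?H) / real L" using L by (simp add: field_simps)
qed

lemma averaging:
  fixes \<Phi> :: "'f \<Rightarrow> real"
  assumes "finite H" "H \<noteq> {}" "(\<Sum>f\<in>H. \<Phi> f) \<le> real (card H) * B"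
  obtains f where "f \<in> H" "\<Phi> f \<le> B"
proof (rule ccontr)
  assume "\<not> thesis"
  then have "\<And>f. f \<in> H \<Longrightarrow> B < \<Phi> f" using that by force
  then have "(\<Sum>f\<in>H. B) < (\<Sum>f\<in>H. \<Phi> f)" using assms by (intro sum_strict_mono) auto
  then show False using assms by simp
qed

text \<open>\<open>C j w\<close> holds the values that decoder \<open>j\<close> cannot rule out. A
  wrong one shares the bin of \<open>X w\<close> for at most one \<open>L\<close>-th of the
  functions; a union bound over candidates and an average over functions give one \<open>f\<close>.
  Summing over \<open>j\<close> first makes it good for all decoders, hence the factor
  \<open>card J\<close>.\<close>

lemma random_binning:
  fixes p :: "'w pmf" and X :: "'w \<Rightarrow> 'x" and C :: "'j \<Rightarrow> 'w \<Rightarrow> 'x set"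
  assumes p: "finite (set_pmf p)" and J: "finite J" and L: "L > 0"
    and fC: "\<And>j w. j \<in> J \<Longrightarrow> w \<in> set_pmf p \<Longrightarrow> finite (C j w)"
    and C: "\<And>j w. j \<in> J \<Longrightarrow> w \<in> set_pmf p \<Longrightarrow> real (card (C j w)) \<le> \<gamma>"
  obtains f :: "'x \<Rightarrow> nat" where "\<And>x. f x < L"
    "\<And>j. j \<in> J \<Longrightarrow> measure_pmf.prob p {w. \<exists>x'\<in>C j w. x' \<noteq> X w \<and> f x' = f (X w)} \<le> real (card J) * \<gamma> / real L"
proof -
  let ?S = "set_pmf p"
  define A where "A = X ` ?S \<union> (\<Union>j\<in>J. \<Union>w\<in>?S. C j w)"
  have fA: "finite A" unfolding A_def using p J fC by auto
  obtain H :: "('x \<Rightarrow> nat) set" where H: "finite H" "H \<noteq> {}" "\<And>f x. f \<in> H \<Longrightarrow> f x < L"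
    and coll: "\<And>x x'. x \<in> A \<Longrightarrow> x' \<in> A \<Longrightarrow> x \<noteq> x' \<Longrightarrow> real (card {f \<in> H. f x = f x'}) \<le> real (card H) / real L"
    by (rule universal_hash_family[OF fA L]) (rule that; blast)
  define E where "E j f = {w. \<exists>x'\<in>C j w. x' \<noteq> X w \<and> f x' = f (X w)}" for j and f :: "'x \<Rightarrow> nat"
  have prob_le: "measure_pmf.prob p (E j f) \<le> (\<Sum>w\<in>?S. \<Sum>x'\<in>C j w - {X w}. pmf p w * of_bool (f x' = f (X w)))"
    if j: "j \<in> J" for j f
    unfolding prob_eq_sum[OF p]
  proof (rule sum_mono)
    fix w assume w: "w \<in> ?S"
    have "(if w \<in> E j f then 1 else 0) \<le> (\<Sum>x'\<in>C j w - {X w}. of_bool (f x' = f (X w)) :: real)"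
    proof (cases "w \<in> E j f")
      case True
      then obtain x' where x': "x' \<in> C j w" "x' \<noteq> X w" "f x' = f (X w)" by (auto simp: E_def)
      have "of_bool (f x' = f (X w)) \<le> (\<Sum>x'\<in>C j w - {X w}. of_bool (f x' = f (X w)) :: real)"
        using x' fC[OF j w] by (intro member_le_sum) auto
      then show ?thesis using True x' by simp
    qed (simp add: sum_nonneg)
    then show "pmf p w * (if w \<in> E j f then 1 else 0)
      \<le> (\<Sum>x'\<in>C j w - {X w}. pmf p w * of_bool (f x' = f (X w)))"
      unfolding sum_distrib_left[symmetric] by (rule mult_left_mono) simp
  qed
  have "(\<Sum>f\<in>H. \<Sum>j\<in>J. measure_pmf.prob p (E j f))
     \<le> (\<Sum>f\<in>H. \<Sum>j\<in>J. \<Sum>w\<in>?S. \<Sum>x'\<in>C j w - {X w}. pmf p w * of_bool (f x' = f (X w)))"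
    by (intro sum_mono prob_le)
  also have "\<dots> = (\<Sum>j\<in>J. \<Sum>w\<in>?S. \<Sum>x'\<in>C j w - {X w}. \<Sum>f\<in>H. pmf p w * of_bool (f x' = f (X w)))"
    by (subst sum.swap, rule sum.cong[OF refl], subst sum.swap, rule sum.cong[OF refl], subst sum.swap, rule refl)
  also have "\<dots> = (\<Sum>j\<in>J. \<Sum>w\<in>?S. \<Sum>x'\<in>C j w - {X w}. pmf p w * real (card {f \<in> H. f x' = f (X w)}))"
    by (intro sum.cong refl) (simp add: sum_distrib_left[symmetric] H Int_def)
  also have "\<dots> \<le> (\<Sum>j\<in>J. \<Sum>w\<in>?S. \<Sum>x'\<in>C j w - {X w}. pmf p w * (real (card H) / real L))"
    by (intro sum_mono mult_left_mono coll) (auto simp: A_def)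
  also have "\<dots> \<le> (\<Sum>j\<in>J. \<Sum>w\<in>?S. \<gamma> * (pmf p w * (real (card H) / real L)))"
  proof (intro sum_mono)
    fix j w assume jw: "j \<in> J" "w \<in> ?S"
    have "real (card (C j w - {X w})) \<le> \<gamma>"
      using C[OF jw] card_Diff1_le[of "C j w" "X w"] fC[OF jw] by linarith
    then show "(\<Sum>x'\<in>C j w - {X w}. pmf p w * (real (card H) / real L))
       \<le> \<gamma> * (pmf p w * (real (card H) / real L))"
      by (simp only: sum_constant) (intro mult_right_mono, auto)
  qed
  also have "\<dots> = real (card H) * (real (card J) * \<gamma> / real L)"
    using p by (simp add: sum_distrib_left[symmetric] sum_divide_distrib[symmetric] sum_distrib_right[symmetric]
        sum_pmf_eq_1 mult_ac)
  finally have "(\<Sum>f\<in>H. \<Sum>j\<in>J. measure_pmf.prob p (E j f)) \<le> real (card H) * (real (card J) * \<gamma> / real L)" .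
  from averaging[OF H(1,2) this] obtain f where f: "f \<in> H"
    and le: "(\<Sum>j\<in>J. measure_pmf.prob p (E j f)) \<le> real (card J) * \<gamma> / real L" by blast
  show thesis
  proof (rule that)
    show "f x < L" for x using H(3) f .
    show "measure_pmf.prob p {w. \<exists>x'\<in>C j w. x' \<noteq> X w \<and> f x' = f (X w)} \<le> real (card J) * \<gamma> / real L"
      if j: "j \<in> J" for j
    proof -
      have "measure_pmf.prob p (E j f) \<le> (\<Sum>j\<in>J. measure_pmf.prob p (E j f))"
        using j J by (intro member_le_sum) auto
      then show ?thesis using le unfolding E_def by linarith
    qed
  qed
qed

text \<open>The part of the source outside \<open>T\<close> is written off; \<open>c\<close> bounds \<open>N\<close> times the conditional collision probability of the key on \<open>T\<close>.\<close>

lemma equivocation_from_collisions: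
  fixes p :: "'x pmf" and G :: "'x \<Rightarrow> nat" and Z :: "'x \<Rightarrow> 'z" and T :: "'x set" and N :: nat
  assumes p: "finite (set_pmf p)" and N: "N > 0" and c: "c \<ge> 1"
  defines "r \<equiv> \<lambda>z. \<Sum>x\<in>{x\<in>set_pmf p \<inter> T. Z x = z}. pmf p x"
  assumes coll: "(\<Sum>x\<in>set_pmf p \<inter> T. \<Sum>x'\<in>{x'\<in>set_pmf p \<inter> T. Z x' = Z x \<and> G x' = G x}.
      real N * pmf p x * pmf p x' / r (Z x)) \<le> c"
  shows "log 2 N - (ent p (\<lambda>x. (G x, Z x)) - ent p Z) \<le> (1 - measure_pmf.prob p T) * log 2 N + (1 + ln c) / ln 2"
proof -
  \<comment> \<open>The indicator of \<open>T\<close> is added to the conditioning, which only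
    lowers the entropy of \<open>G\<close>; on \<open>T\<close> the fibre probabilities are then
    exactly \<open>r\<close> and \<open>rk\<close>.\<close>
  let ?S = "set_pmf p" and ?W = "\<lambda>x. (Z x, x \<in> T)" and ?V = "\<lambda>x. (G x, Z x, x \<in> T)"
  define rk where "rk x = (\<Sum>x'\<in>{x'\<in>?S \<inter> T. Z x' = Z x \<and> G x' = G x}. pmf p x')" for x
  have vimage_sum: "measure_pmf.prob p A = (\<Sum>x\<in>?S \<inter> A. pmf p x)" for A
  proof -
    have "measure_pmf.prob p A = measure_pmf.prob p (?S \<inter> A)"
      by (metis Int_commute measure_Int_set_pmf)
    then show ?thesis using p by (simp add: measure_measure_pmf_finite)
  qed
  have W: "pmf (map_pmf ?W p) (?W x) = r (Z x)" if "x \<in> ?S \<inter> T" for x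
    unfolding pmf_map vimage_sum r_def using that by (intro sum.cong) auto
  have V: "pmf (map_pmf ?V p) (?V x) = rk x" if "x \<in> ?S \<inter> T" for x
    unfolding pmf_map vimage_sum rk_def using that by (intro sum.cong) auto
  have posW: "0 < pmf (map_pmf ?W p) (?W x)" and posV: "0 < pmf (map_pmf ?V p) (?V x)"
    and WV: "pmf (map_pmf ?V p) (?V x) \<le> pmf (map_pmf ?W p) (?W x)" if "x \<in> ?S" for x
  proof -
    show "0 < pmf (map_pmf ?W p) (?W x)" by (rule pmf_map_pos[OF that, of ?W])
    show "0 < pmf (map_pmf ?V p) (?V x)" by (rule pmf_map_pos[OF that, of ?V])
    show "pmf (map_pmf ?V p) (?V x) \<le> pmf (map_pmf ?W p) (?W x)"
      unfolding pmf_map by (rule measure_pmf.finite_measure_mono) auto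
  qed
  have "ent p (\<lambda>x. (G x, ?W x)) - ent p ?W \<le> ent p (\<lambda>x. (G x, Z x)) - ent p Z"
    by (rule ent_cond_antimono[OF p]) simp
  moreover have "(\<Sum>x\<in>?S. pmf p x * (log 2 (pmf (map_pmf ?W p) (?W x)) - log 2 (pmf (map_pmf ?V p) (?V x))))
    = ent p ?V - ent p ?W"
    by (simp add: ent_def right_diff_distrib sum_subtractf)
  \<comment> \<open>Points outside \<open>T\<close> contribute nonnegative amounts to the
    conditional entropy and are dropped.\<close>
  moreover have "(\<Sum>x\<in>?S \<inter> T. pmf p x * (log 2 (pmf (map_pmf ?W p) (?W x)) - log 2 (pmf (map_pmf ?V p) (?V x))))
    \<le> (\<Sum>x\<in>?S. pmf p x * (log 2 (pmf (map_pmf ?W p) (?W x)) - log 2 (pmf (map_pmf ?V p) (?V x))))"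
  proof (rule sum_mono2[OF p])
    fix x assume x: "x \<in> ?S - ?S \<inter> T"
    then have "log 2 (pmf (map_pmf ?V p) (?V x)) \<le> log 2 (pmf (map_pmf ?W p) (?W x))"
      using posV[of x] WV[of x] by (intro log_mono) auto
    then show "0 \<le> pmf p x * (log 2 (pmf (map_pmf ?W p) (?W x)) - log 2 (pmf (map_pmf ?V p) (?V x)))"
      by (intro mult_nonneg_nonneg) auto
  qed auto
  moreover have "(\<Sum>x\<in>?S \<inter> T. pmf p x * log 2 N
       - pmf p x * (log 2 (pmf (map_pmf ?W p) (?W x)) - log 2 (pmf (map_pmf ?V p) (?V x))))
     \<le> (\<Sum>x\<in>?S \<inter> T. (real N * pmf p x * rk x / r (Z x) / c + pmf p x * (ln c - 1)) / ln 2)"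
  proof (rule sum_mono)
    fix x assume x: "x \<in> ?S \<inter> T"
    have pos: "0 < r (Z x)" "0 < rk x" using posW[of x] posV[of x] W[OF x] V[OF x] x by auto
    let ?t = "real N * rk x / r (Z x)"
    have t: "?t > 0" using pos N by simp
    \<comment> \<open>The tangent of \<open>ln\<close> at \<open>c\<close>, the bound on the mean of
      \<open>?t\<close>, takes the place of Jensen's inequality: the loss is logarithmic in
      \<open>c\<close>.\<close>
    have "ln (?t / c) \<le> ?t / c - 1" using divide_pos_pos[OF t, of c] c by (intro ln_le_minus_one) simp
    then have ln_t: "ln ?t \<le> ?t / c - 1 + ln c" using ln_divide_pos[OF t, of c] c by linarith
    have "log 2 N - (log 2 (r (Z x)) - log 2 (rk x)) = log 2 ?t"
      using pos N by (simp add: log_divide log_mult)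
    also have "\<dots> \<le> (?t / c - 1 + ln c) / ln 2"
      unfolding log_def using ln_t by (intro divide_right_mono) auto
    finally have "pmf p x * (log 2 N - (log 2 (r (Z x)) - log 2 (rk x))) \<le> pmf p x * ((?t / c - 1 + ln c) / ln 2)"
      by (rule mult_left_mono) simp
    then show "pmf p x * log 2 N
       - pmf p x * (log 2 (pmf (map_pmf ?W p) (?W x)) - log 2 (pmf (map_pmf ?V p) (?V x)))
     \<le> (real N * pmf p x * rk x / r (Z x) / c + pmf p x * (ln c - 1)) / ln 2"
      unfolding W[OF x] V[OF x] by (simp add: algebra_simps)
  qed
  moreover have "(\<Sum>x\<in>?S \<inter> T. (real N * pmf p x * rk x / r (Z x) / c + pmf p x * (ln c - 1)) / ln 2)
    \<le> (1 + ln c) / ln 2"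
  proof -
    have "(\<Sum>x\<in>?S \<inter> T. real N * pmf p x * rk x / r (Z x)) \<le> c"
      using coll by (simp add: rk_def sum_distrib_left sum_divide_distrib)
    then have a: "(\<Sum>x\<in>?S \<inter> T. real N * pmf p x * rk x / r (Z x)) / c \<le> 1"
      using c by simp
    have "measure_pmf.prob p T * (ln c - 1) \<le> measure_pmf.prob p T * ln c"
      by (intro mult_left_mono) auto
    also have "\<dots> \<le> 1 * ln c" using c by (intro mult_right_mono) auto
    finally have "(\<Sum>x\<in>?S \<inter> T. pmf p x) * (ln c - 1) \<le> ln c" by (simp add: vimage_sum)
    with a have "(\<Sum>x\<in>?S \<inter> T. real N * pmf p x * rk x / r (Z x)) / c + (\<Sum>x\<in>?S \<inter> T. pmf p x) * (ln c - 1)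
      \<le> 1 + ln c" by linarith
    then have "((\<Sum>x\<in>?S \<inter> T. real N * pmf p x * rk x / r (Z x)) / c + (\<Sum>x\<in>?S \<inter> T. pmf p x) * (ln c - 1)) / ln 2
      \<le> (1 + ln c) / ln 2" by (rule divide_right_mono) simp
    then show ?thesis
      by (simp only: sum.distrib sum_divide_distrib[symmetric] sum_distrib_right[symmetric])
  qed
  moreover have "(\<Sum>x\<in>?S \<inter> T. pmf p x * log 2 N) = measure_pmf.prob p T * log 2 N"
    by (simp add: vimage_sum sum_distrib_right)
  ultimately show ?thesis by (simp add: sum_subtractf left_diff_distrib)
qed

text \<open>A leftover hash lemma for several observers. For a random \<open>G\<close>, colliding
  pairs of distinct points contribute at most 1 to the collision sum. Equal points contribute
  \<open>N\<close> times the mean of \<open>pmf p x\<close> divided by the mass of its fibre, which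
  \<open>\<beta>\<close> bounds by \<open>\<gamma>\<close>. Adding over the observers yields one
  \<open>G\<close> for all of them, at the price of \<open>card J\<close>.\<close>

lemma privacy_amplification:
  fixes \<beta> :: "'j \<Rightarrow> 'z \<Rightarrow> real" and \<gamma> :: real and p :: "'x pmf" and Z :: "'j \<Rightarrow> 'x \<Rightarrow> 'z" and T :: "'x set" and N :: nat
  assumes p: "finite (set_pmf p)" and J: "finite J" "J \<noteq> {}" and N: "N > 0"
    and \<beta>: "\<And>j x. j \<in> J \<Longrightarrow> x \<in> set_pmf p \<inter> T \<Longrightarrow> pmf p x \<le> \<beta> j (Z j x)"
    and \<gamma>: "\<And>j. j \<in> J \<Longrightarrow> (\<Sum>z\<in>Z j ` (set_pmf p \<inter> T). \<beta> j z) \<le> \<gamma>" "\<gamma> \<ge> 0"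
  obtains G :: "'x \<Rightarrow> nat" where "\<And>x. G x < N"
    "\<And>j. j \<in> J \<Longrightarrow> log 2 N - (ent p (\<lambda>x. (G x, Z j x)) - ent p (Z j))
       \<le> (1 - measure_pmf.prob p T) * log 2 N + (1 + ln (card J * (1 + N * \<gamma>))) / ln 2"
proof -
  let ?S = "set_pmf p \<inter> T"
  have fS: "finite ?S" using p by simp
  define r where "r j z = (\<Sum>x\<in>{x\<in>?S. Z j x = z}. pmf p x)" for j z
  define Q where "Q j G = (\<Sum>x\<in>?S. \<Sum>x'\<in>{x'\<in>?S. Z j x' = Z j x \<and> G x' = G x}.
      real N * pmf p x * pmf p x' / r j (Z j x))" for j and G :: "'x \<Rightarrow> nat"
  obtain H :: "('x \<Rightarrow> nat) set" where H: "finite H" "H \<noteq> {}" "\<And>f x. f \<in> H \<Longrightarrow> f x < N"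
    and coll: "\<And>x x'. x \<in> ?S \<Longrightarrow> x' \<in> ?S \<Longrightarrow> x \<noteq> x' \<Longrightarrow> real (card {f \<in> H. f x = f x'}) \<le> real (card H) / real N"
    by (rule universal_hash_family[OF fS N]) (rule that; blast)
  have r_pos: "r j (Z j x) > 0" if "x \<in> ?S" for j x
    unfolding r_def using p that by (intro sum_pos) (auto simp: pmf_positive)
  have E: "(\<Sum>G\<in>H. Q j G) \<le> real (card H) * (1 + N * \<gamma>)" if j: "j \<in> J" for j
  proof -
    have "(\<Sum>G\<in>H. Q j G) = (\<Sum>G\<in>H. \<Sum>x\<in>?S. \<Sum>x'\<in>{x'\<in>?S. Z j x' = Z j x}.
        of_bool (G x' = G x) * (real N * pmf p x * pmf p x' / r j (Z j x)))"
      unfolding Q_def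
      by (rule sum.cong[OF refl], rule sum.cong[OF refl], rule sum.mono_neutral_cong_left) (use p in auto)
    also have "\<dots> = (\<Sum>x\<in>?S. \<Sum>x'\<in>{x'\<in>?S. Z j x' = Z j x}. \<Sum>G\<in>H.
        of_bool (G x' = G x) * (real N * pmf p x * pmf p x' / r j (Z j x)))"
      by (subst sum.swap, rule sum.cong[OF refl], subst sum.swap, rule refl)
    also have "\<dots> = (\<Sum>x\<in>?S. \<Sum>x'\<in>{x'\<in>?S. Z j x' = Z j x}.
        real (card {G\<in>H. G x' = G x}) * (real N * pmf p x * pmf p x' / r j (Z j x)))"
      by (intro sum.cong refl, subst sum_distrib_right[symmetric]) (simp add: H Int_def)
    \<comment> \<open>Equal points collide under every function, distinct ones under at most one
      \<open>N\<close>-th of them; \<open>N * of_bool (x' = x) + 1\<close> covers both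
      cases.\<close>
    also have "\<dots> \<le> (\<Sum>x\<in>?S. \<Sum>x'\<in>{x'\<in>?S. Z j x' = Z j x}.
        real (card H) * (real N * of_bool (x' = x) + 1) * (pmf p x * pmf p x' / r j (Z j x)))"
    proof (intro sum_mono)
      fix x x' assume x: "x \<in> ?S" "x' \<in> {x'\<in>?S. Z j x' = Z j x}"
      have "real (card {G\<in>H. G x' = G x}) * real N \<le> real (card H) * (real N * of_bool (x' = x) + 1)"
      proof (cases "x' = x")
        case False
        then show ?thesis using coll[of x' x] x N by (simp add: field_simps)
      qed (simp add: algebra_simps)
      then have "real (card {G\<in>H. G x' = G x}) * real N * (pmf p x * pmf p x' / r j (Z j x))
        \<le> real (card H) * (real N * of_bool (x' = x) + 1) * (pmf p x * pmf p x' / r j (Z j x))"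
        using r_pos[OF x(1), of j] by (intro mult_right_mono) auto
      then show "real (card {G\<in>H. G x' = G x}) * (real N * pmf p x * pmf p x' / r j (Z j x))
        \<le> real (card H) * (real N * of_bool (x' = x) + 1) * (pmf p x * pmf p x' / r j (Z j x))"
        by (simp add: mult_ac)
    qed
    also have "\<dots> = (\<Sum>x\<in>?S. real (card H) * (real N * (pmf p x * pmf p x / r j (Z j x)) + pmf p x))"
    proof (rule sum.cong[OF refl])
      fix x assume x: "x \<in> ?S"
      have f: "finite {x'\<in>?S. Z j x' = Z j x}" using p by simp
      have "(\<Sum>x'\<in>{x'\<in>?S. Z j x' = Z j x}.
          real (card H) * (real N * of_bool (x' = x) + 1) * (pmf p x * pmf p x' / r j (Z j x)))
        = (\<Sum>x'\<in>{x'\<in>?S. Z j x' = Z j x}.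
          (if x' = x then real (card H) * real N * (pmf p x * pmf p x / r j (Z j x)) else 0)
           + real (card H) * pmf p x / r j (Z j x) * pmf p x')"
        by (rule sum.cong[OF refl]) (auto simp: algebra_simps add_divide_distrib)
      also have "\<dots> = real (card H) * real N * (pmf p x * pmf p x / r j (Z j x))
          + real (card H) * pmf p x / r j (Z j x) * r j (Z j x)"
        unfolding sum.distrib sum_distrib_left[symmetric] r_def using x f by (simp add: sum.delta)
      also have "\<dots> = real (card H) * (real N * (pmf p x * pmf p x / r j (Z j x)) + pmf p x)"
        using r_pos[OF x, of j] by (simp add: algebra_simps)
      finally show "(\<Sum>x'\<in>{x'\<in>?S. Z j x' = Z j x}.
          real (card H) * (real N * of_bool (x' = x) + 1) * (pmf p x * pmf p x' / r j (Z j x)))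
        = real (card H) * (real N * (pmf p x * pmf p x / r j (Z j x)) + pmf p x)" .
    qed
    also have "\<dots> = real (card H) * (real N * (\<Sum>x\<in>?S. pmf p x * pmf p x / r j (Z j x)) + (\<Sum>x\<in>?S. pmf p x))"
      by (simp add: sum_distrib_left sum.distrib distrib_left)
    also have "\<dots> \<le> real (card H) * (real N * \<gamma> + 1)"
    proof (intro mult_left_mono add_mono)
      \<comment> \<open>One factor \<open>pmf p x\<close> is replaced by \<open>\<beta>\<close>,
        constant on fibres of \<open>Z j\<close>; the other sums over a fibre to \<open>r\<close>,
        which cancels.\<close>
      have "(\<Sum>x\<in>?S. pmf p x * pmf p x / r j (Z j x)) \<le> (\<Sum>x\<in>?S. \<beta> j (Z j x) * pmf p x / r j (Z j x))"
        using \<beta>[OF j] r_pos[of _ j] by (intro sum_mono divide_right_mono mult_right_mono) (auto simp: less_imp_le)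
      also have "\<dots> = (\<Sum>z\<in>Z j ` ?S. \<Sum>x\<in>{x\<in>?S. Z j x = z}. \<beta> j (Z j x) * pmf p x / r j (Z j x))"
        by (rule sum.image_gen[OF fS])
      also have "\<dots> = (\<Sum>z\<in>Z j ` ?S. \<beta> j z)"
      proof (rule sum.cong[OF refl])
        fix z assume "z \<in> Z j ` ?S"
        then have rz: "r j z > 0" using r_pos by auto
        have "(\<Sum>x\<in>{x\<in>?S. Z j x = z}. \<beta> j (Z j x) * pmf p x / r j (Z j x)) = \<beta> j z / r j z * r j z"
          unfolding r_def sum_distrib_left by (intro sum.cong) auto
        then show "(\<Sum>x\<in>{x\<in>?S. Z j x = z}. \<beta> j (Z j x) * pmf p x / r j (Z j x)) = \<beta> j z"
          using rz by simp
      qed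
      also have "\<dots> \<le> \<gamma>" by (rule \<gamma>(1)[OF j])
      finally show "(\<Sum>x\<in>?S. pmf p x * pmf p x / r j (Z j x)) \<le> \<gamma>" .
      have "(\<Sum>x\<in>?S. pmf p x) = measure_pmf.prob p ?S" using fS by (simp add: measure_measure_pmf_finite)
      then show "(\<Sum>x\<in>?S. pmf p x) \<le> 1" by simp
    qed auto
    finally show ?thesis by (simp add: add.commute)
  qed
  have "(\<Sum>G\<in>H. \<Sum>j\<in>J. Q j G) = (\<Sum>j\<in>J. \<Sum>G\<in>H. Q j G)" by (rule sum.swap)
  also have "\<dots> \<le> (\<Sum>j\<in>J. real (card H) * (1 + N * \<gamma>))" by (intro sum_mono E)
  finally have "(\<Sum>G\<in>H. \<Sum>j\<in>J. Q j G) \<le> real (card H) * (real (card J) * (1 + N * \<gamma>))" by (simp add: mult_ac)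
  from averaging[OF H(1,2) this] obtain G where G: "G \<in> H"
    and le: "(\<Sum>j\<in>J. Q j G) \<le> real (card J) * (1 + N * \<gamma>)" by blast
  have Q_nonneg: "Q j G \<ge> 0" for j
    unfolding Q_def using r_pos[of _ j] by (intro sum_nonneg divide_nonneg_nonneg) (auto simp: less_imp_le)
  show thesis
  proof (rule that)
    show "G x < N" for x using H(3) G .
    fix j assume j: "j \<in> J"
    have "Q j G \<le> (\<Sum>j\<in>J. Q j G)" using j J Q_nonneg by (intro member_le_sum) auto
    then have Q: "Q j G \<le> card J * (1 + N * \<gamma>)" using le by linarith
    have "1 * 1 \<le> real (card J) * (1 + N * \<gamma>)"
      using J \<gamma>(2) by (intro mult_mono) (auto simp: Suc_le_eq card_gt_0_iff)
    then show "log 2 N - (ent p (\<lambda>x. (G x, Z j x)) - ent p (Z j))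
       \<le> (1 - measure_pmf.prob p T) * log 2 N + (1 + ln (card J * (1 + N * \<gamma>))) / ln 2"
      using Q by (intro equivocation_from_collisions[OF p N]) (auto simp: Q_def r_def)
  qed
qed

section \<open>The relay broadcast code\<close>

lemma ent_const [simp]: "ent p (\<lambda>_. c) = 0"
  by (simp add: ent_def pmf_map)

lemma ent_nonneg: "finite (set_pmf p) \<Longrightarrow> 0 \<le> ent p X"
  using ent_mono[of p X "\<lambda>_. ()"] by simp

lemma ent_pair_le:
  assumes p: "finite (set_pmf p)"
  shows "ent p (\<lambda>w. (X w, Y w)) \<le> ent p X + ent p Y"
proof -
  have "ent p (\<lambda>w. (X w, ())) = ent p X" by (rule ent_cong[OF p]) simp
  then show ?thesis using ent_cond_antimono[OF p, of Y "\<lambda>_. ()" X] by simp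
qed

lemma pmf_map_cong_kernel:
  assumes "\<And>w'. X w' = X w \<longleftrightarrow> Y w' = Y w"
  shows "pmf (map_pmf X p) (X w) = pmf (map_pmf Y p) (Y w)"
  unfolding pmf_map using assms by (intro arg_cong[where f="measure_pmf.prob p"]) auto

section \<open>Single-letter rates of the relays\<close>

definition relay_ent :: "(nat \<Rightarrow> party \<Rightarrow> ('a \<times> 'a) pmf) \<Rightarrow> nat \<Rightarrow> real" where
  "relay_ent P i = ent (P i PA) snd + ent (P i PB) snd"

definition relays_mask :: "nat \<Rightarrow> mask" where
  "relays_mask M = (\<Union>i\<in>{1..M}. tmask (Relay i))"

lemma mask_ent_split:
  "mask_ent M P K = (\<Sum>i\<in>{1..M}. ent (P i PA) (sel K (i, PA)) + ent (P i PB) (sel K (i, PB)))"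
proof -
  have "mask_ent M P K = (\<Sum>i\<in>{1..M}. \<Sum>\<alpha>\<in>{PA, PB}. ent (case_prod P (i, \<alpha>)) (sel K (i, \<alpha>)))"
    unfolding mask_ent_def links_def sum.cartesian_product by (simp add: case_prod_unfold)
  then show ?thesis by simp
qed

context
  fixes P :: "nat \<Rightarrow> party \<Rightarrow> ('a::finite \<times> 'a) pmf"
begin

lemma mask_ent_relay:
  assumes "m \<in> {1..M}"
  shows "mask_ent M P (tmask (Relay m)) = relay_ent P m"
proof -
  have "mask_ent M P (tmask (Relay m)) = (\<Sum>i\<in>{1..M}. if i = m then relay_ent P m else 0)"
    unfolding mask_ent_split by (rule sum.cong) (auto simp: ent_sel tmask_def relay_ent_def)
  then show ?thesis using assms by (simp add: sum.delta)
qed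

lemma mask_ent_relays: "mask_ent M P (relays_mask M) = (\<Sum>i\<in>{1..M}. relay_ent P i)"
  unfolding mask_ent_split by (rule sum.cong) (auto simp: ent_sel tmask_def relay_ent_def relays_mask_def)

lemma pin_rate_bounds: "0 \<le> pin_rate P i" "pin_rate P i \<le> relay_ent P i"
proof -
  have "ent (P i \<alpha>) (\<lambda>x. (fst x, snd x)) \<le> ent (P i \<alpha>) fst + ent (P i \<alpha>) snd"
    "ent (P i \<alpha>) fst \<le> ent (P i \<alpha>) (\<lambda>x. (fst x, snd x))" for \<alpha>
    by (rule ent_pair_le, simp, rule ent_mono, auto)
  then have "0 \<le> mutual_info_pmf (P i \<alpha>) fst snd" "mutual_info_pmf (P i \<alpha>) fst snd \<le> ent (P i \<alpha>) snd" for \<alpha>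
    by (simp_all add: mutual_info_eq_ent)
  moreover have "0 \<le> ent (P i PB) snd" by (simp add: ent_nonneg)
  ultimately show "0 \<le> pin_rate P i" "pin_rate P i \<le> relay_ent P i"
    unfolding pin_rate_def relay_ent_def by (auto simp: min_le_iff_disj intro: add_increasing2)
qed

text \<open>Among the components held by \<open>\<sigma>\<close> only its link to relay
  \<open>i\<close> is correlated with that relay. Its mutual information is at least the minimum
  \<open>pin_rate P i\<close>, so one bin rate suffices for Alice and for Bob.\<close>

lemma mask_ent_decode:
  assumes i: "i \<in> {1..M}" and \<sigma>: "\<sigma> \<in> {Alice, Bob}"
  shows "mask_ent M P (tmask (Relay i) \<union> tmask \<sigma>) \<le> mask_ent M P (tmask \<sigma>) + relay_ent P i - pin_rate P i"
proof -
  have "mask_ent M P (tmask (Relay i) \<union> tmask \<sigma>) - mask_ent M P (tmask \<sigma>)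
    = (\<Sum>j\<in>{1..M}. if j = i then relay_ent P i - mutual_info_pmf (P i (if \<sigma> = Alice then PA else PB)) fst snd else 0)"
    unfolding mask_ent_split sum_subtractf[symmetric]
    using \<sigma> by (intro sum.cong) (auto simp: ent_sel tmask_def relay_ent_def mutual_info_eq_ent)
  also have "\<dots> \<le> relay_ent P i - pin_rate P i"
    using i by (simp add: sum.delta pin_rate_def)
  finally show ?thesis by simp
qed

end

text \<open>The finitely many views whose probabilities are compared: a decoder alone and with a
  relay for decoding, one relay and all relays together for secrecy.\<close>

definition typ_masks :: "nat \<Rightarrow> mask set" where
  "typ_masks M = insert (relays_mask M) (tmask ` ({Alice, Bob} \<union> Relay ` {1..M})
     \<union> (\<lambda>(i, \<sigma>). tmask (Relay i) \<union> tmask \<sigma>) ` ({1..M} \<times> {Alice, Bob}))"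

definition atypical :: "nat \<Rightarrow> nat \<Rightarrow> (nat \<Rightarrow> party \<Rightarrow> ('a \<times> 'a) pmf) \<Rightarrow> real \<Rightarrow> 'a sample set" where
  "atypical M n P \<delta> = {\<omega>. \<exists>K\<in>typ_masks M.
     \<bar>log 2 (pmf (map_pmf (mview M n K) (pin_source M n P)) (mview M n K \<omega>)) + real n * mask_ent M P K\<bar> \<ge> real n * \<delta>}"

lemma atypical_small:
  fixes P :: "nat \<Rightarrow> party \<Rightarrow> ('a::finite \<times> 'a) pmf"
  assumes "\<delta> > 0" "e > 0"
  shows "\<forall>\<^sub>F n in sequentially. measure_pmf.prob (pin_source M n P) (atypical M n P \<delta>) \<le> e"
proof -
  let ?A = "\<lambda>n K. {\<omega>. \<bar>log 2 (pmf (map_pmf (mview M n K) (pin_source M n P)) (mview M n K \<omega>))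
         + real n * mask_ent M P K\<bar> \<ge> real n * \<delta>}"
  let ?c = "real (card (typ_masks M))"
  have fin: "finite (typ_masks M)" by (simp add: typ_masks_def)
  have c: "?c > 0" using fin by (auto simp: card_gt_0_iff typ_masks_def)
  have "\<forall>\<^sub>F n in sequentially. \<forall>K\<in>typ_masks M. measure_pmf.prob (pin_source M n P) (?A n K) \<le> e / ?c"
    using assms c by (intro eventually_ball_finite fin ballI mview_aep) auto
  then show ?thesis
  proof eventually_elim
    case (elim n)
    have "atypical M n P \<delta> = (\<Union>K\<in>typ_masks M. ?A n K)" by (auto simp: atypical_def)
    then have "measure_pmf.prob (pin_source M n P) (atypical M n P \<delta>)
       \<le> (\<Sum>K\<in>typ_masks M. measure_pmf.prob (pin_source M n P) (?A n K))"
      using fin by (simp add: measure_pmf.finite_measure_subadditive_finite)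
    also have "\<dots> \<le> (\<Sum>K\<in>typ_masks M. e / ?c)" using elim by (intro sum_mono) auto
    also have "\<dots> = e" using c by simp
    finally show ?case .
  qed
qed

text \<open>Stated for any \<open>X\<close> with the fibre of the masked view at \<omega>, so that
  it applies directly to tuples and lists of terminal views.\<close>

lemma typical_pmf_bounds:
  fixes P :: "nat \<Rightarrow> party \<Rightarrow> ('a::finite \<times> 'a) pmf"
  assumes \<omega>: "\<omega> \<in> set_pmf (pin_source M n P)" "\<omega> \<notin> atypical M n P \<delta>" and K: "K \<in> typ_masks M"
    and X: "\<And>\<omega>'. X \<omega>' = X \<omega> \<longleftrightarrow> mview M n K \<omega>' = mview M n K \<omega>"
  shows "pmf (map_pmf X (pin_source M n P)) (X \<omega>) \<le> 2 powr (- (real n * (mask_ent M P K - \<delta>)))"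
    and "2 powr (- (real n * (mask_ent M P K + \<delta>))) \<le> pmf (map_pmf X (pin_source M n P)) (X \<omega>)"
proof -
  let ?q = "pmf (map_pmf X (pin_source M n P)) (X \<omega>)"
  have q: "?q = pmf (map_pmf (mview M n K) (pin_source M n P)) (mview M n K \<omega>)"
    by (rule pmf_map_cong_kernel) (rule X)
  have pos: "?q > 0" by (rule pmf_map_pos[OF \<omega>(1)])
  have "\<not> real n * \<delta> \<le> \<bar>log 2 ?q + real n * mask_ent M P K\<bar>"
    using \<omega>(2) K unfolding q atypical_def by blast
  then have "log 2 ?q \<le> - (real n * (mask_ent M P K - \<delta>))" "- (real n * (mask_ent M P K + \<delta>)) \<le> log 2 ?q"
    by (simp_all add: algebra_simps abs_less_iff)
  then show "?q \<le> 2 powr (- (real n * (mask_ent M P K - \<delta>)))"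
    "2 powr (- (real n * (mask_ent M P K + \<delta>))) \<le> ?q"
    using pos by (simp_all add: log_le_iff le_log_iff)
qed

text \<open>Of the margin \<open>3 * \<delta>\<close>, two parts pay for the typicality errors in
  the candidate count and the third makes the decoding error decay.\<close>

definition bin_count :: "nat \<Rightarrow> (nat \<Rightarrow> party \<Rightarrow> ('a \<times> 'a) pmf) \<Rightarrow> real \<Rightarrow> nat \<Rightarrow> nat" where
  "bin_count n P \<delta> i = nat \<lceil>2 powr (real n * (relay_ent P i - pin_rate P i + 3 * \<delta>))\<rceil>"

lemma bin_count_bounds:
  fixes P :: "nat \<Rightarrow> party \<Rightarrow> ('a::finite \<times> 'a) pmf"
  assumes "\<delta> > 0"
  shows "2 powr (real n * (relay_ent P i - pin_rate P i + 3 * \<delta>)) \<le> real (bin_count n P \<delta> i)"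
    and "real (bin_count n P \<delta> i) \<le> 2 * 2 powr (real n * (relay_ent P i - pin_rate P i + 3 * \<delta>))"
    and "bin_count n P \<delta> i > 0"
proof -
  let ?x = "2 powr (real n * (relay_ent P i - pin_rate P i + 3 * \<delta>)) :: real"
  have "1 \<le> ?x" using pin_rate_bounds(2)[of P i] assms by (intro ge_one_powr_ge_zero) auto
  then show "?x \<le> real (bin_count n P \<delta> i)" "real (bin_count n P \<delta> i) \<le> 2 * ?x" "bin_count n P \<delta> i > 0"
    unfolding bin_count_def by linarith+
qed

text \<open>The decoder looks in the announced bin for a value of conditional probability at least
  \<open>1 / \<gamma>\<close>. There are at most \<open>\<gamma>\<close> of these, since conditional
  probabilities sum to at most 1, and the true value is among them for typical samples. Only a
  collision in random binning can then mislead it.\<close>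

lemma relay_code:
  fixes P :: "nat \<Rightarrow> party \<Rightarrow> ('a::finite \<times> 'a) pmf"
  assumes i: "i \<in> {1..M}" and \<delta>: "\<delta> > 0"
  obtains f :: "'a view \<Rightarrow> nat" and dec :: "terminal \<Rightarrow> 'a view \<Rightarrow> nat \<Rightarrow> 'a view" where
    "\<And>x. f x < bin_count n P \<delta> i"
    "\<And>\<sigma>. \<sigma> \<in> {Alice, Bob} \<Longrightarrow> measure_pmf.prob (pin_source M n P) {\<omega>. \<omega> \<notin> atypical M n P \<delta> \<and>
        dec \<sigma> (terminal_view M n \<sigma> \<omega>) (f (terminal_view M n (Relay i) \<omega>)) \<noteq> terminal_view M n (Relay i) \<omega>}
      \<le> 2 * 2 powr (- (real n * \<delta>))"
proof -
  let ?p = "pin_source M n P" and ?X = "terminal_view M n (Relay i)" and ?L = "bin_count n P \<delta> i"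
  define \<gamma> :: real where "\<gamma> = 2 powr (real n * (relay_ent P i - pin_rate P i + 2 * \<delta>))"
  define cand where "cand \<sigma> s = {x \<in> ?X ` set_pmf ?p. pmf (map_pmf (terminal_view M n \<sigma>) ?p) s
      \<le> \<gamma> * pmf (map_pmf (\<lambda>\<omega>. (?X \<omega>, terminal_view M n \<sigma> \<omega>)) ?p) (x, s)}" for \<sigma> s
  note fin = finite_set_pin_source[of M n P]
  have fcand: "finite (cand \<sigma> s)" for \<sigma> s using fin by (simp add: cand_def)
  have \<gamma>: "\<gamma> > 0" by (simp add: \<gamma>_def)
  have card: "real (card (cand \<sigma> (terminal_view M n \<sigma> \<omega>))) \<le> \<gamma>" if \<omega>: "\<omega> \<in> set_pmf ?p" for \<sigma> \<omega>
  proof -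
    let ?s = "terminal_view M n \<sigma> \<omega>" and ?J = "map_pmf (\<lambda>\<omega>. (?X \<omega>, terminal_view M n \<sigma> \<omega>)) ?p"
    let ?q = "pmf (map_pmf (terminal_view M n \<sigma>) ?p) ?s"
    have q: "?q > 0" by (rule pmf_map_pos[OF \<omega>])
    have "real (card (cand \<sigma> ?s)) * ?q = (\<Sum>x\<in>cand \<sigma> ?s. ?q)" by simp
    also have "\<dots> \<le> (\<Sum>x\<in>cand \<sigma> ?s. \<gamma> * pmf ?J (x, ?s))" by (rule sum_mono) (simp add: cand_def)
    also have "\<dots> = \<gamma> * measure_pmf.prob ?J ((\<lambda>x. (x, ?s)) ` cand \<sigma> ?s)"
      using fcand by (subst measure_measure_pmf_finite) (auto simp: sum.reindex inj_on_def sum_distrib_left)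
    also have "\<dots> \<le> \<gamma> * ?q"
      using \<gamma> by (intro mult_left_mono) (auto simp: pmf_map intro!: measure_pmf.finite_measure_mono)
    finally show ?thesis using q by simp
  qed
  obtain f :: "'a view \<Rightarrow> nat" where f: "\<And>x. f x < ?L"
    and coll: "\<And>\<sigma>. \<sigma> \<in> {Alice, Bob} \<Longrightarrow> measure_pmf.prob ?p
      {\<omega>. \<exists>x'\<in>cand \<sigma> (terminal_view M n \<sigma> \<omega>). x' \<noteq> ?X \<omega> \<and> f x' = f (?X \<omega>)} \<le> real (card {Alice, Bob}) * \<gamma> / real ?L"
    by (rule random_binning[OF fin, of "{Alice, Bob}" ?L "\<lambda>\<sigma> \<omega>. cand \<sigma> (terminal_view M n \<sigma> \<omega>)" \<gamma> ?X])
      (use fcand card bin_count_bounds(3)[OF \<delta>] in auto)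
  define dec where "dec \<sigma> s b = (SOME x. x \<in> cand \<sigma> s \<and> f x = b)" for \<sigma> s b
  \<comment> \<open>The factor 2 counts the two decoders served by the same bin map.\<close>
  have rate: "2 * \<gamma> / real ?L \<le> 2 * 2 powr (- (real n * \<delta>))"
  proof -
    have "\<gamma> = 2 powr (- (real n * \<delta>)) * 2 powr (real n * (relay_ent P i - pin_rate P i + 3 * \<delta>))"
      by (simp add: \<gamma>_def algebra_simps flip: powr_add)
    also have "\<dots> \<le> 2 powr (- (real n * \<delta>)) * real ?L"
      using bin_count_bounds(1)[OF \<delta>] by (intro mult_left_mono) auto
    finally show ?thesis using bin_count_bounds(3)[OF \<delta>, of n P i] by (simp add: field_simps)
  qed
  have typical_cand: "?X \<omega> \<in> cand \<sigma> (terminal_view M n \<sigma> \<omega>)"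
    if \<omega>: "\<omega> \<in> set_pmf ?p" "\<omega> \<notin> atypical M n P \<delta>" and \<sigma>: "\<sigma> \<in> {Alice, Bob}" for \<omega> \<sigma>
  proof -
    let ?q = "pmf (map_pmf (terminal_view M n \<sigma>) ?p) (terminal_view M n \<sigma> \<omega>)"
    let ?r = "pmf (map_pmf (\<lambda>\<omega>. (?X \<omega>, terminal_view M n \<sigma> \<omega>)) ?p) (?X \<omega>, terminal_view M n \<sigma> \<omega>)"
    have "?q \<le> 2 powr (- (real n * (mask_ent M P (tmask \<sigma>) - \<delta>)))"
      using \<sigma> by (intro typical_pmf_bounds(1)[OF \<omega>]) (auto simp: typ_masks_def terminal_view_eq_iff)
    also have "\<dots> \<le> 2 powr (real n * (relay_ent P i - pin_rate P i + 2 * \<delta>)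
       + - (real n * (mask_ent M P (tmask (Relay i) \<union> tmask \<sigma>) + \<delta>)))"
      using mult_left_mono[OF mask_ent_decode[OF i \<sigma>, of P], of "real n"]
      by (intro powr_mono) (auto simp: algebra_simps)
    also have "\<dots> = \<gamma> * 2 powr (- (real n * (mask_ent M P (tmask (Relay i) \<union> tmask \<sigma>) + \<delta>)))"
      unfolding \<gamma>_def by (rule powr_add)
    also have "\<dots> \<le> \<gamma> * ?r"
      using i \<sigma> \<gamma>
      by (intro mult_left_mono typical_pmf_bounds(2)[OF \<omega>, where X="\<lambda>\<omega>. (?X \<omega>, terminal_view M n \<sigma> \<omega>)"])
        (auto simp: typ_masks_def terminal_view_eq_iff mview_Un)
    finally show ?thesis using \<omega>(1) by (simp add: cand_def)
  qed
  show thesis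
  proof (rule that[OF f])
    fix \<sigma> assume \<sigma>: "\<sigma> \<in> {Alice, Bob}"
    have "measure_pmf.prob ?p {\<omega>. \<omega> \<notin> atypical M n P \<delta> \<and> dec \<sigma> (terminal_view M n \<sigma> \<omega>) (f (?X \<omega>)) \<noteq> ?X \<omega>}
       \<le> measure_pmf.prob ?p {\<omega>. \<exists>x'\<in>cand \<sigma> (terminal_view M n \<sigma> \<omega>). x' \<noteq> ?X \<omega> \<and> f x' = f (?X \<omega>)}"
    proof (rule measure_pmf.finite_measure_mono_AE)
      show "AE \<omega> in measure_pmf ?p.
        \<omega> \<in> {\<omega>. \<omega> \<notin> atypical M n P \<delta> \<and> dec \<sigma> (terminal_view M n \<sigma> \<omega>) (f (?X \<omega>)) \<noteq> ?X \<omega>} \<longrightarrow>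
        \<omega> \<in> {\<omega>. \<exists>x'\<in>cand \<sigma> (terminal_view M n \<sigma> \<omega>). x' \<noteq> ?X \<omega> \<and> f x' = f (?X \<omega>)}"
      proof (simp add: AE_measure_pmf_iff, intro ballI impI, elim conjE)
        fix \<omega> assume \<omega>: "\<omega> \<in> set_pmf ?p" "\<omega> \<notin> atypical M n P \<delta>"
          and ne: "dec \<sigma> (terminal_view M n \<sigma> \<omega>) (f (?X \<omega>)) \<noteq> ?X \<omega>"
        have "\<exists>x. x \<in> cand \<sigma> (terminal_view M n \<sigma> \<omega>) \<and> f x = f (?X \<omega>)"
          using typical_cand[OF \<omega> \<sigma>] by blast
        from someI_ex[OF this, folded dec_def] ne
        show "\<exists>x'\<in>cand \<sigma> (terminal_view M n \<sigma> \<omega>). x' \<noteq> ?X \<omega> \<and> f x' = f (?X \<omega>)" by blast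
      qed
    qed auto
    also have "\<dots> \<le> 2 * 2 powr (- (real n * \<delta>))"
      using coll[OF \<sigma>] rate by simp
    finally show "measure_pmf.prob ?p {\<omega>. \<omega> \<notin> atypical M n P \<delta> \<and>
       dec \<sigma> (terminal_view M n \<sigma> \<omega>) (f (?X \<omega>)) \<noteq> ?X \<omega>} \<le> 2 * 2 powr (- (real n * \<delta>))" .
  qed
qed

section \<open>From the relay codes to a key protocol\<close>

lemma transmitter_relay: "l \<in> {1..M} \<Longrightarrow> transmitter M l = Relay l"
  by (auto simp: transmitter_def)

lemma run_relay_protocol:
  assumes "l \<le> M"
  shows "run_protocol M (\<lambda>l x fs. return_pmf (f l x)) v l = return_pmf (map (\<lambda>i. f i (v (Relay i))) [1..<l+1])"
  using assms
proof (induction l)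
  case (Suc l)
  then show ?case by (simp add: bind_return_pmf transmitter_relay del: upt_Suc) (simp add: upt_Suc)
qed simp

text \<open>This is the \<open>\<gamma>\<close> of privacy amplification for relay \<open>m\<close>:
  the conditional probability of the other relays' views times the number of bin tuples. The relay
  entropies cancel and the rates \<open>pin_rate\<close> remain. \<open>2 ^ M\<close> comes from
  rounding the bin counts.\<close>

lemma bins_product_bound:
  fixes P :: "nat \<Rightarrow> party \<Rightarrow> ('a::finite \<times> 'a) pmf"
  assumes m: "m \<in> {1..M}" and \<delta>: "\<delta> > 0" and R: "R \<le> (\<Sum>i\<in>{1..M} - {m}. pin_rate P i)"
  shows "2 powr (- (real n * ((\<Sum>i\<in>{1..M} - {m}. relay_ent P i) - 2 * \<delta>)))
      * (\<Prod>i\<in>{1..M} - {m}. real (bin_count n P \<delta> i))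
    \<le> 2 ^ M * 2 powr (real n * ((3 * real M + 2) * \<delta> - R))"
proof -
  let ?I = "{1..M} - {m}"
  have c: "card ?I \<le> M" using m by simp
  have "(\<Prod>i\<in>?I. real (bin_count n P \<delta> i))
      \<le> (\<Prod>i\<in>?I. 2 * 2 powr (real n * (relay_ent P i - pin_rate P i + 3 * \<delta>)))"
    by (intro prod_mono) (simp add: bin_count_bounds(2)[OF \<delta>])
  also have "\<dots> = 2 ^ card ?I * 2 powr (\<Sum>i\<in>?I. real n * (relay_ent P i - pin_rate P i + 3 * \<delta>))"
    by (simp add: prod.distrib powr_sum)
  also have "\<dots> \<le> 2 ^ M * 2 powr (\<Sum>i\<in>?I. real n * (relay_ent P i - pin_rate P i + 3 * \<delta>))"
    using c by (intro mult_right_mono power_increasing) auto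
  finally have "2 powr (- (real n * ((\<Sum>i\<in>?I. relay_ent P i) - 2 * \<delta>))) * (\<Prod>i\<in>?I. real (bin_count n P \<delta> i))
     \<le> 2 powr (- (real n * ((\<Sum>i\<in>?I. relay_ent P i) - 2 * \<delta>)))
       * (2 ^ M * 2 powr (\<Sum>i\<in>?I. real n * (relay_ent P i - pin_rate P i + 3 * \<delta>)))"
    by (rule mult_left_mono) simp
  also have "\<dots> = 2 ^ M * 2 powr (- (real n * ((\<Sum>i\<in>?I. relay_ent P i) - 2 * \<delta>))
       + (\<Sum>i\<in>?I. real n * (relay_ent P i - pin_rate P i + 3 * \<delta>)))"
    by (simp only: powr_add mult_ac)
  also have "- (real n * ((\<Sum>i\<in>?I. relay_ent P i) - 2 * \<delta>))
       + (\<Sum>i\<in>?I. real n * (relay_ent P i - pin_rate P i + 3 * \<delta>))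
     = real n * (2 * \<delta> - (\<Sum>i\<in>?I. pin_rate P i) + real (card ?I) * (3 * \<delta>))"
    by (simp add: sum_distrib_left[symmetric] sum.distrib sum_subtractf algebra_simps)
  also have "2 ^ M * 2 powr (real n * (2 * \<delta> - (\<Sum>i\<in>?I. pin_rate P i) + real (card ?I) * (3 * \<delta>)))
     \<le> 2 ^ M * 2 powr (real n * ((3 * real M + 2) * \<delta> - R))"
  proof (intro mult_left_mono powr_mono)
    have "real (card ?I) * (3 * \<delta>) \<le> real M * (3 * \<delta>)" using c \<delta> by (intro mult_right_mono) auto
    then show "2 * \<delta> - (\<Sum>i\<in>?I. pin_rate P i) + real (card ?I) * (3 * \<delta>) \<le> (3 * real M + 2) * \<delta> - R"
      using R by (simp add: algebra_simps)
  qed auto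
  finally show ?thesis .
qed

text \<open>\<open>D\<close> collects the atypical part, the hashing loss and a Fano term, the last
  because Alice's computed key may differ from the ideal key, the hash of the true relay views.
  \<open>M\<close> rounds suffice, since round \<open>i\<close> belongs to relay
  \<open>i\<close>.\<close>

lemma code_exists:
  fixes P :: "nat \<Rightarrow> party \<Rightarrow> ('a::finite \<times> 'a) pmf" and M n N :: nat and \<delta> e R :: real
  assumes M: "M \<ge> 1" and \<delta>: "\<delta> > 0" and e: "0 < e" "e < 1" and N: "N > 0"
    and R: "\<forall>m\<in>{1..M}. R \<le> (\<Sum>i\<in>{1..M} - {m}. pin_rate P i)"
    and err: "measure_pmf.prob (pin_source M n P) (atypical M n P \<delta>) + 4 * M * 2 powr (- (real n * \<delta>)) \<le> e"
  defines "D \<equiv> e * log 2 N + (1 + ln (M * (1 + N * (2 ^ M * 2 powr (real n * ((3 * real M + 2) * \<delta> - R)))))) / ln 2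
      + (e * log 2 N - log 2 (1 - e) - e * log 2 e)"
  shows "\<exists>(\<phi> :: nat \<Rightarrow> 'a view \<Rightarrow> nat list \<Rightarrow> nat pmf) (KA :: 'a view \<Rightarrow> nat list \<Rightarrow> nat) KB L.
     (\<forall>x fs. KA x fs \<in> {..<N}) \<and> (\<forall>l x fs. set_pmf (\<phi> l x fs) \<subseteq> {..<L}) \<and>
     (let \<Omega> = outcome M n P M \<phi>;
          keyA = (\<lambda>(\<omega>, fs). KA (terminal_view M n Alice \<omega>) fs);
          keyB = (\<lambda>(\<omega>, fs). KB (terminal_view M n Bob \<omega>) fs)
      in measure_pmf.prob \<Omega> {w. keyA w \<noteq> keyB w} \<le> e
       \<and> entropy_pmf (map_pmf keyA \<Omega>) \<ge> log 2 N - D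
       \<and> (\<forall>m\<in>{1..M}. mutual_info_pmf \<Omega> keyA (\<lambda>(\<omega>, fs). (terminal_view M n (Relay m) \<omega>, fs)) \<le> D))"
proof -
  let ?p = "pin_source M n P"
  define V where "V = (\<lambda>i (\<omega> :: 'a sample). terminal_view M n (Relay i) \<omega>)"
  define I where "I = {1..M}"
  note fin = finite_set_pin_source[of M n P]
  have "\<forall>i\<in>I. \<exists>f dec. (\<forall>x. f x < bin_count n P \<delta> i) \<and> (\<forall>\<sigma>\<in>{Alice, Bob}.
      measure_pmf.prob ?p {\<omega>. \<omega> \<notin> atypical M n P \<delta> \<and>
        dec \<sigma> (terminal_view M n \<sigma> \<omega>) (f (V i \<omega>)) \<noteq> V i \<omega>} \<le> 2 * 2 powr (- (real n * \<delta>)))"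
  proof
    fix i assume "i \<in> I"
    then have "i \<in> {1..M}" by (simp add: I_def)
    from relay_code[OF this \<delta>] obtain g and d :: "terminal \<Rightarrow> 'a view \<Rightarrow> nat \<Rightarrow> 'a view"
      where "\<And>x. g x < bin_count n P \<delta> i"
      "\<And>\<sigma>. \<sigma> \<in> {Alice, Bob} \<Longrightarrow> measure_pmf.prob ?p {\<omega>. \<omega> \<notin> atypical M n P \<delta> \<and>
        d \<sigma> (terminal_view M n \<sigma> \<omega>) (g (V i \<omega>)) \<noteq> V i \<omega>} \<le> 2 * 2 powr (- (real n * \<delta>))"
      unfolding V_def by blast
    then show "\<exists>f dec. (\<forall>x. f x < bin_count n P \<delta> i) \<and> (\<forall>\<sigma>\<in>{Alice, Bob}.
      measure_pmf.prob ?p {\<omega>. \<omega> \<notin> atypical M n P \<delta> \<and>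
        dec \<sigma> (terminal_view M n \<sigma> \<omega>) (f (V i \<omega>)) \<noteq> V i \<omega>} \<le> 2 * 2 powr (- (real n * \<delta>)))"
      by (intro exI[of _ g] exI[of _ d] conjI allI ballI)
  qed
  then obtain f0 where "\<forall>i\<in>I. \<exists>dec. (\<forall>x. f0 i x < bin_count n P \<delta> i) \<and> (\<forall>\<sigma>\<in>{Alice, Bob}.
      measure_pmf.prob ?p {\<omega>. \<omega> \<notin> atypical M n P \<delta> \<and>
        dec \<sigma> (terminal_view M n \<sigma> \<omega>) (f0 i (V i \<omega>)) \<noteq> V i \<omega>} \<le> 2 * 2 powr (- (real n * \<delta>)))"
    by (rule bchoice[THEN exE])
  then obtain dec where code: "\<forall>i\<in>I. (\<forall>x. f0 i x < bin_count n P \<delta> i) \<and> (\<forall>\<sigma>\<in>{Alice, Bob}.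
      measure_pmf.prob ?p {\<omega>. \<omega> \<notin> atypical M n P \<delta> \<and>
        dec i \<sigma> (terminal_view M n \<sigma> \<omega>) (f0 i (V i \<omega>)) \<noteq> V i \<omega>} \<le> 2 * 2 powr (- (real n * \<delta>)))"
    by (rule bchoice[THEN exE])
  \<comment> \<open>The default 0 outside \<open>I\<close> bounds the message alphabet in every
    round, as the code format demands.\<close>
  define f where "f i x = (if i \<in> I then f0 i x else 0)" for i x
  have f: "f i x < bin_count n P \<delta> i" if "i \<in> I" for i x using code that by (simp add: f_def)
  define E where "E i \<sigma> = {\<omega>. \<omega> \<notin> atypical M n P \<delta> \<and>
      dec i \<sigma> (terminal_view M n \<sigma> \<omega>) (f i (V i \<omega>)) \<noteq> V i \<omega>}" for i \<sigma>
  have E: "measure_pmf.prob ?p (E i \<sigma>) \<le> 2 * 2 powr (- (real n * \<delta>))" if "i \<in> I" "\<sigma> \<in> {Alice, Bob}" for i \<sigma>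
    using bspec[OF conjunct2[OF bspec[OF code that(1)]] that(2)] that(1) unfolding E_def f_def by simp
  define Er where "Er = atypical M n P \<delta> \<union> (\<Union>b\<in>I \<times> {Alice, Bob}. E (fst b) (snd b))"
  have Er: "measure_pmf.prob ?p Er \<le> e"
  proof -
    have "measure_pmf.prob ?p Er \<le> measure_pmf.prob ?p (atypical M n P \<delta>)
       + measure_pmf.prob ?p (\<Union>b\<in>I \<times> {Alice, Bob}. E (fst b) (snd b))"
      unfolding Er_def by (rule measure_Un_le) auto
    also have "measure_pmf.prob ?p (\<Union>b\<in>I \<times> {Alice, Bob}. E (fst b) (snd b))
       \<le> (\<Sum>b\<in>I \<times> {Alice, Bob}. measure_pmf.prob ?p (E (fst b) (snd b)))"
      by (rule measure_pmf.finite_measure_subadditive_finite) (auto simp: I_def)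
    also have "\<dots> \<le> (\<Sum>b\<in>I \<times> {Alice, Bob}. 2 * 2 powr (- (real n * \<delta>)))"
      by (intro sum_mono E) auto
    \<comment> \<open>\<open>M\<close> relays, two decoders, and failure probability
      \<open>2 * 2 powr (- (real n * \<delta>))\<close> for each pair.\<close>
    also have "\<dots> = 4 * M * 2 powr (- (real n * \<delta>))"
      by (simp add: I_def card_cartesian_product)
    finally show ?thesis using err by simp
  qed
  define X where "X = (\<lambda>\<omega>. map (\<lambda>i. V i \<omega>) [1..<M+1])"
  define F where "F = (\<lambda>\<omega>. map (\<lambda>i. f i (V i \<omega>)) [1..<M+1])"
  have X_nth: "X \<omega> ! (i - 1) = V i \<omega>" and F_nth: "F \<omega> ! (i - 1) = f i (V i \<omega>)" if "i \<in> I" for i \<omega>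
    using that by (auto simp: X_def F_def I_def nth_upt simp del: upt_Suc)
  have X_eq: "X \<omega> = X \<omega>' \<longleftrightarrow> (\<forall>i\<in>I. V i \<omega> = V i \<omega>')" for \<omega> \<omega>'
    unfolding X_def I_def by auto
  have F_eq: "F \<omega> = F \<omega>' \<longleftrightarrow> (\<forall>i\<in>I. f i (V i \<omega>) = f i (V i \<omega>'))" for \<omega> \<omega>'
    unfolding F_def I_def by auto
  \<comment> \<open>What relay \<open>m\<close> knows, as a function of the list of all relay views
    (relay \<open>i\<close> at position \<open>i - 1\<close>). Its own bin index follows from its
    view and is left out, so that it is not counted as a leak.\<close>
  define Z where "Z m xs = (xs ! (m - 1), \<lambda>i\<in>I - {m}. f i (xs ! (i - 1)))" for m xs
  have Z_X: "Z m (X \<omega>) = (V m \<omega>, \<lambda>i\<in>I - {m}. f i (V i \<omega>))" if "m \<in> I" for m \<omega>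
    unfolding Z_def X_nth[OF that]
    by (rule arg_cong[where f="Pair _"], rule restrict_ext, rule arg_cong[where f="f _"], rule X_nth, blast)
  \<comment> \<open>For typical samples the joint law of all relays is small and that of relay
    \<open>m\<close> is not; their quotient gives this exponent, with one \<delta> lost in each
    estimate.\<close>
  define \<beta> where "\<beta> m z = 2 powr (- (real n * ((\<Sum>i\<in>I - {m}. relay_ent P i) - 2 * \<delta>))) * pmf (map_pmf (V m) ?p) (fst z)"
    for m and z :: "'a view \<times> (nat \<Rightarrow> nat)"
  let ?p' = "map_pmf X ?p"
  have fin': "finite (set_pmf ?p')" using fin by simp
  \<comment> \<open>\<open>T\<close> is the very inequality that privacy amplification asks for;
    typical samples are shown to fall into it.\<close>
  define T where "T = {xs. \<forall>m\<in>I. pmf ?p' xs \<le> \<beta> m (Z m xs)}"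
  define \<gamma> :: real where "\<gamma> = 2 ^ M * 2 powr (real n * ((3 * real M + 2) * \<delta> - R))"
  have sum_\<beta>: "(\<Sum>z\<in>Z m ` (set_pmf ?p' \<inter> T). \<beta> m z) \<le> \<gamma>" if m: "m \<in> I" for m
  proof -
    let ?b = "2 powr (- (real n * ((\<Sum>i\<in>I - {m}. relay_ent P i) - 2 * \<delta>)))"
    let ?Q = "PiE (I - {m}) (\<lambda>i. {..<bin_count n P \<delta> i})"
    have finQ: "finite ?Q" by (intro finite_PiE) (auto simp: I_def)
    \<comment> \<open>Enlarging the range to a product lets the relay's probabilities sum to 1 and
      leaves the number of bin tuples as a factor.\<close>
    have "(\<Sum>z\<in>Z m ` (set_pmf ?p' \<inter> T). \<beta> m z) \<le> (\<Sum>z\<in>V m ` set_pmf ?p \<times> ?Q. \<beta> m z)"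
    proof (rule sum_mono2)
      show "finite (V m ` set_pmf ?p \<times> ?Q)" using fin finQ by simp
      show "Z m ` (set_pmf ?p' \<inter> T) \<subseteq> V m ` set_pmf ?p \<times> ?Q"
      proof (rule image_subsetI)
        fix xs assume "xs \<in> set_pmf ?p' \<inter> T"
        then obtain \<omega> where \<omega>: "\<omega> \<in> set_pmf ?p" and xs: "xs = X \<omega>" by auto
        show "Z m xs \<in> V m ` set_pmf ?p \<times> ?Q"
          unfolding xs Z_X[OF m] using f \<omega> by (simp add: restrict_PiE_iff)
      qed
    qed (simp add: \<beta>_def)
    also have "\<dots> = (\<Sum>x\<in>V m ` set_pmf ?p. \<Sum>g\<in>?Q. ?b * pmf (map_pmf (V m) ?p) x)"
      by (simp only: \<beta>_def sum.cartesian_product case_prod_unfold)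
    also have "\<dots> = ?b * real (card ?Q) * (\<Sum>x\<in>V m ` set_pmf ?p. pmf (map_pmf (V m) ?p) x)"
      unfolding sum_constant sum_distrib_left by (simp only: mult_ac)
    also have "(\<Sum>x\<in>V m ` set_pmf ?p. pmf (map_pmf (V m) ?p) x) = 1"
      using fin by (intro sum_pmf_eq_1) auto
    also have "real (card ?Q) = (\<Prod>i\<in>I - {m}. real (bin_count n P \<delta> i))"
      by (subst card_PiE) (auto simp: I_def)
    finally show ?thesis
      using bins_product_bound[where m=m and n=n, OF _ \<delta> bspec[OF R]] m unfolding \<gamma>_def I_def by simp
  qed
  have prob_T: "1 - measure_pmf.prob ?p' T \<le> e"
  proof -
    have typ_T: "X \<omega> \<in> T" if \<omega>: "\<omega> \<in> set_pmf ?p" "\<omega> \<notin> atypical M n P \<delta>" for \<omega>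
      unfolding T_def
    proof (intro CollectI ballI)
      fix m assume m: "m \<in> I"
      have sum: "(\<Sum>i\<in>I. relay_ent P i) = relay_ent P m + (\<Sum>i\<in>I - {m}. relay_ent P i)"
        using m by (intro sum.remove) (auto simp: I_def)
      have "pmf ?p' (X \<omega>) \<le> 2 powr (- (real n * (mask_ent M P (relays_mask M) - \<delta>)))"
      proof (rule typical_pmf_bounds(1)[OF \<omega>])
        show "X \<omega>' = X \<omega> \<longleftrightarrow> mview M n (relays_mask M) \<omega>' = mview M n (relays_mask M) \<omega>" for \<omega>'
          unfolding X_eq V_def terminal_view_eq_iff I_def relays_mask_def mview_eq_iff sel_eq_iff by blast
      qed (simp add: typ_masks_def)
      also have "\<dots> = 2 powr (- (real n * ((\<Sum>i\<in>I - {m}. relay_ent P i) - 2 * \<delta>))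
          + - (real n * (mask_ent M P (tmask (Relay m)) + \<delta>)))"
        using m sum by (simp add: mask_ent_relays mask_ent_relay I_def algebra_simps)
      also have "\<dots> = 2 powr (- (real n * ((\<Sum>i\<in>I - {m}. relay_ent P i) - 2 * \<delta>)))
          * 2 powr (- (real n * (mask_ent M P (tmask (Relay m)) + \<delta>)))"
        by (rule powr_add)
      also have "\<dots> \<le> \<beta> m (Z m (X \<omega>))"
        unfolding \<beta>_def Z_X[OF m] fst_conv using m
        by (intro mult_left_mono typical_pmf_bounds(2)[OF \<omega>])
          (auto simp: typ_masks_def V_def terminal_view_eq_iff I_def)
      finally show "pmf ?p' (X \<omega>) \<le> \<beta> m (Z m (X \<omega>))" .
    qed
    have "measure_pmf.prob ?p (- atypical M n P \<delta>) \<le> measure_pmf.prob ?p (X -` T)"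
      using typ_T by (intro measure_pmf.finite_measure_mono_AE) (auto simp: AE_measure_pmf_iff)
    moreover have "measure_pmf.prob ?p (- atypical M n P \<delta>) = 1 - measure_pmf.prob ?p (atypical M n P \<delta>)"
      using measure_pmf.prob_compl[of "atypical M n P \<delta>" ?p] by (simp add: Compl_eq_Diff_UNIV)
    moreover have "0 \<le> 4 * real M * 2 powr (- (real n * \<delta>))" by simp
    ultimately show ?thesis using err unfolding measure_map_pmf by linarith
  qed
  have I: "finite I" "I \<noteq> {}" "card I = M" using M by (auto simp: I_def)
  have \<gamma>0: "\<gamma> \<ge> 0" by (simp add: \<gamma>_def)
  have \<beta>T: "pmf ?p' x \<le> \<beta> m (Z m x)" if "m \<in> I" "x \<in> set_pmf ?p' \<inter> T" for m x
    using that by (auto simp: T_def)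
  have "\<exists>G :: 'a view list \<Rightarrow> nat. (\<forall>x. G x < N) \<and> (\<forall>m\<in>I. log 2 N - (ent ?p' (\<lambda>x. (G x, Z m x)) - ent ?p' (Z m))
       \<le> (1 - measure_pmf.prob ?p' T) * log 2 N + (1 + ln (card I * (1 + N * \<gamma>))) / ln 2)"
  proof (rule privacy_amplification[where T=T and Z=Z and \<beta>=\<beta> and \<gamma>=\<gamma>, OF fin' I(1,2) N])
    fix G :: "'a view list \<Rightarrow> nat"
    assume "\<And>x. G x < N" "\<And>m. m \<in> I \<Longrightarrow> log 2 N - (ent ?p' (\<lambda>x. (G x, Z m x)) - ent ?p' (Z m))
       \<le> (1 - measure_pmf.prob ?p' T) * log 2 N + (1 + ln (card I * (1 + N * \<gamma>))) / ln 2"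
    then show "\<exists>G :: 'a view list \<Rightarrow> nat. (\<forall>x. G x < N) \<and> (\<forall>m\<in>I. log 2 N - (ent ?p' (\<lambda>x. (G x, Z m x)) - ent ?p' (Z m))
       \<le> (1 - measure_pmf.prob ?p' T) * log 2 N + (1 + ln (card I * (1 + N * \<gamma>))) / ln 2)"
      by blast
  qed (use \<beta>T sum_\<beta> \<gamma>0 in auto)
  then obtain G :: "'a view list \<Rightarrow> nat" where G: "\<And>x. G x < N"
    and sec: "\<And>m. m \<in> I \<Longrightarrow> log 2 N - (ent ?p' (\<lambda>x. (G x, Z m x)) - ent ?p' (Z m))
       \<le> (1 - measure_pmf.prob ?p' T) * log 2 N + (1 + ln (card I * (1 + N * \<gamma>))) / ln 2"
    by blast
  define key where "key \<sigma> s fs = G (map (\<lambda>i. dec i \<sigma> s (fs ! (i - 1))) [1..<M+1])" for \<sigma> s fs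
  define kA where "kA = (\<lambda>\<omega>. key Alice (terminal_view M n Alice \<omega>) (F \<omega>))"
  define kB where "kB = (\<lambda>\<omega>. key Bob (terminal_view M n Bob \<omega>) (F \<omega>))"
  define K where "K = G \<circ> X"
  have key_ok: "key \<sigma> (terminal_view M n \<sigma> \<omega>) (F \<omega>) = K \<omega>" if "\<omega> \<notin> Er" "\<sigma> \<in> {Alice, Bob}" for \<omega> \<sigma>
  proof -
    have "dec i \<sigma> (terminal_view M n \<sigma> \<omega>) (F \<omega> ! (i - 1)) = V i \<omega>" if i: "i \<in> I" for i
      using \<open>\<omega> \<notin> Er\<close> \<open>\<sigma> \<in> {Alice, Bob}\<close> i unfolding Er_def E_def F_nth[OF i] by auto
    then have "map (\<lambda>i. dec i \<sigma> (terminal_view M n \<sigma> \<omega>) (F \<omega> ! (i - 1))) [1..<M+1] = X \<omega>"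
      unfolding X_def by (intro map_cong) (auto simp: I_def)
    then show ?thesis by (simp add: key_def K_def)
  qed
  have errAB: "measure_pmf.prob ?p {\<omega>. kA \<omega> \<noteq> kB \<omega>} \<le> e"
    and errKA: "measure_pmf.prob ?p {\<omega>. K \<omega> \<noteq> kA \<omega>} \<le> e"
    using key_ok by (intro order_trans[OF measure_pmf.finite_measure_mono Er]; force simp: kA_def kB_def)+
  define \<phi> where "\<phi> = (\<lambda>l (x :: 'a view) (fs :: nat list). return_pmf (f l x))"
  define L where "L = Suc (\<Sum>i\<in>I. bin_count n P \<delta> i)"
  have out: "outcome M n P M \<phi> = map_pmf (\<lambda>\<omega>. (\<omega>, F \<omega>)) ?p"
    unfolding outcome_def \<phi>_def
    by (simp add: run_relay_protocol map_pmf_def bind_return_pmf F_def V_def del: upt_Suc)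
  have L: "set_pmf (\<phi> l x fs) \<subseteq> {..<L}" for l x fs
  proof (cases "l \<in> I")
    case True
    then have "f l x < bin_count n P \<delta> l" by (rule f)
    also have "\<dots> \<le> (\<Sum>i\<in>I. bin_count n P \<delta> i)" using True I by (intro member_le_sum) auto
    finally show ?thesis by (simp add: \<phi>_def L_def)
  qed (simp add: \<phi>_def L_def f_def)
  have fano_K: "ent ?p (\<lambda>\<omega>. (K \<omega>, kA \<omega>)) - ent ?p kA \<le> e * log 2 N - log 2 (1 - e) - e * log 2 e"
    using fano[OF fin, of "{..<N}" K e kA] G e errKA by (simp add: K_def)
  have joint: "log 2 N - D \<le> ent ?p (\<lambda>\<omega>. (kA \<omega>, V m \<omega>, F \<omega>)) - ent ?p (\<lambda>\<omega>. (V m \<omega>, F \<omega>))"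
    if m: "m \<in> I" for m
  proof -
    have ZF: "Z m (X \<omega>) = Z m (X \<omega>') \<longleftrightarrow> (V m \<omega>, F \<omega>) = (V m \<omega>', F \<omega>')" for \<omega> \<omega>'
    proof -
      have "(\<lambda>i\<in>I - {m}. f i (V i \<omega>)) = (\<lambda>i\<in>I - {m}. f i (V i \<omega>'))
         \<longleftrightarrow> (\<forall>i\<in>I - {m}. f i (V i \<omega>) = f i (V i \<omega>'))"
        unfolding restrict_def fun_eq_iff by (auto split: if_splits)
      moreover have "(\<forall>i\<in>I - {m}. f i (V i \<omega>) = f i (V i \<omega>')) \<longleftrightarrow> (\<forall>i\<in>I. f i (V i \<omega>) = f i (V i \<omega>'))"
        if "V m \<omega> = V m \<omega>'"
      proof -
        have "f m (V m \<omega>) = f m (V m \<omega>')" by (rule arg_cong[OF that])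
        then show ?thesis by blast
      qed
      ultimately show ?thesis unfolding Z_X[OF m] prod.inject F_eq by blast
    qed
    have "ent ?p' (Z m) = ent ?p (\<lambda>\<omega>. (V m \<omega>, F \<omega>))"
      unfolding ent_map_pmf[OF fin] by (rule ent_cong[OF fin]) (simp add: ZF)
    moreover have "ent ?p' (\<lambda>x. (G x, Z m x)) = ent ?p (\<lambda>\<omega>. (K \<omega>, V m \<omega>, F \<omega>))"
      unfolding ent_map_pmf[OF fin] by (rule ent_cong[OF fin]) (simp add: ZF K_def)
    \<comment> \<open>Secrecy passes from the ideal key to Alice's: the two conditional entropies
      differ by at most the entropy of \<open>K\<close> given \<open>kA\<close>.\<close>
    moreover have "ent ?p (\<lambda>\<omega>. (K \<omega>, V m \<omega>, F \<omega>)) \<le> ent ?p (\<lambda>\<omega>. (K \<omega>, kA \<omega>, V m \<omega>, F \<omega>))"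
      by (rule ent_mono[OF fin]) simp
    moreover have "ent ?p (\<lambda>\<omega>. (K \<omega>, kA \<omega>, V m \<omega>, F \<omega>)) - ent ?p (\<lambda>\<omega>. (kA \<omega>, V m \<omega>, F \<omega>))
       \<le> ent ?p (\<lambda>\<omega>. (K \<omega>, kA \<omega>)) - ent ?p kA"
      by (rule ent_cond_antimono[OF fin]) simp
    moreover have "(1 - measure_pmf.prob ?p' T) * log 2 N \<le> e * log 2 N"
      using prob_T N by (intro mult_right_mono) auto
    ultimately show ?thesis
      using sec[OF m] fano_K unfolding D_def \<gamma>_def[symmetric] I(3) by linarith
  qed
  have kA_le: "ent ?p kA \<le> log 2 N"
    using ent_le_log_card[OF fin, of "{..<N}" kA] G by (simp add: kA_def key_def)
  have fin_out: "finite (set_pmf (outcome M n P M \<phi>))" unfolding out using fin by simp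
  let ?\<Omega> = "outcome M n P M \<phi>"
  let ?keyA = "\<lambda>(\<omega>, fs). key Alice (terminal_view M n Alice \<omega>) fs"
  let ?keyB = "\<lambda>(\<omega>, fs). key Bob (terminal_view M n Bob \<omega>) fs"
  have c1: "measure_pmf.prob ?\<Omega> {w. ?keyA w \<noteq> ?keyB w} \<le> e"
    using errAB by (simp add: out kA_def kB_def)
  have ent_kA: "ent ?\<Omega> ?keyA = ent ?p kA"
    unfolding out ent_map_pmf[OF fin] by (simp add: o_def kA_def)
  have c2: "log 2 N - D \<le> entropy_pmf (map_pmf ?keyA ?\<Omega>)"
  proof -
    \<comment> \<open>Any relay will do: conditioning does not raise entropy, so secrecy from it
      already yields near-uniformity.\<close>
    obtain m where m: "m \<in> I" using I by auto
    have "ent ?p (\<lambda>\<omega>. (kA \<omega>, V m \<omega>, F \<omega>)) \<le> ent ?p kA + ent ?p (\<lambda>\<omega>. (V m \<omega>, F \<omega>))"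
      by (rule ent_pair_le[OF fin])
    then show ?thesis using joint[OF m] ent_kA by (simp add: ent_eq_entropy_pmf[OF fin_out, symmetric])
  qed
  have c3: "mutual_info_pmf ?\<Omega> ?keyA (\<lambda>(\<omega>, fs). (terminal_view M n (Relay m) \<omega>, fs)) \<le> D"
    if m: "m \<in> I" for m
  proof -
    have "ent ?\<Omega> (\<lambda>(\<omega>, fs). (terminal_view M n (Relay m) \<omega>, fs)) = ent ?p (\<lambda>\<omega>. (V m \<omega>, F \<omega>))"
      "ent ?\<Omega> (\<lambda>w. (?keyA w, case w of (\<omega>, fs) \<Rightarrow> (terminal_view M n (Relay m) \<omega>, fs)))
        = ent ?p (\<lambda>\<omega>. (kA \<omega>, V m \<omega>, F \<omega>))"
      unfolding out ent_map_pmf[OF fin] by (simp_all add: o_def kA_def V_def)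
    then show ?thesis
      using joint[OF m] kA_le ent_kA by (simp add: mutual_info_eq_ent[OF fin_out])
  qed
  have c0: "key Alice x fs \<in> {..<N}" for x fs using G by (simp add: key_def)
  show ?thesis
    unfolding Let_def
    by (rule exI[of _ \<phi>], rule exI[of _ "key Alice"], rule exI[of _ "key Bob"], rule exI[of _ L],
        intro conjI allI ballI c0 c1 c2 c3 L) (simp add: I_def)
qed

section \<open>Choice of the constants and the block length\<close>

lemma cut_achievable:
  fixes P :: "nat \<Rightarrow> party \<Rightarrow> ('a::finite \<times> 'a) pmf"
  assumes M: "M \<ge> 1" and R0: "0 \<le> R" and R: "\<forall>m\<in>{1..M}. R \<le> (\<Sum>i\<in>{1..M} - {m}. pin_rate P i)"
  shows "achievable M P R"
  unfolding achievable_def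
proof (intro allI impI)
  fix \<epsilon> :: real assume \<epsilon>: "\<epsilon> > 0"
  \<comment> \<open>The budget for \<open>D\<close> is \<open>n * \<epsilon>\<close>: a quarter for
    the exponent \<open>(3 * M + 2) * \<delta>\<close>, half for the two terms
    \<open>e * log 2 N\<close>, and a quarter for the part \<open>c\<close> that does not grow with
    \<open>n\<close>.\<close>
  define \<delta> where "\<delta> = \<epsilon> / (4 * (3 * real M + 2))"
  define e where "e = min (1/2) (min \<epsilon> (\<epsilon> / (4 * (R + 1))))"
  have \<delta>: "\<delta> > 0" using \<epsilon> by (simp add: \<delta>_def)
  have e: "0 < e" "e < 1" "e \<le> \<epsilon>" "2 * e * (R + 1) \<le> \<epsilon> / 2"
  proof -
    show "0 < e" "e < 1" "e \<le> \<epsilon>" using \<epsilon> R0 by (auto simp: e_def min_def)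
    have "e \<le> \<epsilon> / (4 * (R + 1))" by (simp add: e_def)
    then show "2 * e * (R + 1) \<le> \<epsilon> / 2" using R0 by (simp add: field_simps)
  qed
  define c where "c = 1 / ln 2 + log 2 M + M + 2 - log 2 (1 - e) - e * log 2 e"
  have "\<forall>\<^sub>F n in sequentially. measure_pmf.prob (pin_source M n P) (atypical M n P \<delta>) \<le> e / 2"
    by (rule atypical_small[OF \<delta>]) (use e in simp)
  moreover have "\<forall>\<^sub>F n in sequentially. 4 * M * 2 powr (- (real n * \<delta>)) \<le> e / 2"
  proof -
    have "((\<lambda>n. 4 * real M * 2 powr (- (real n * \<delta>))) \<longlongrightarrow> 0) sequentially"
      using \<delta> by real_asymp
    then have "\<forall>\<^sub>F n in sequentially. 4 * M * 2 powr (- (real n * \<delta>)) < e / 2"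
      using e by (intro order_tendstoD(2)) auto
    then show ?thesis by eventually_elim simp
  qed
  moreover have "\<forall>\<^sub>F n in sequentially. c / (\<epsilon> / 4) \<le> real n"
    using filterlim_real_sequentially unfolding filterlim_at_top by blast
  moreover have "\<forall>\<^sub>F n :: nat in sequentially. 0 < n" by (rule eventually_gt_at_top)
  ultimately have "\<forall>\<^sub>F n in sequentially. 0 < n \<and> c / (\<epsilon> / 4) \<le> real n \<and>
      measure_pmf.prob (pin_source M n P) (atypical M n P \<delta>) + 4 * M * 2 powr (- (real n * \<delta>)) \<le> e"
    by eventually_elim auto
  then obtain n where n: "0 < n" and cn: "c \<le> real n * (\<epsilon> / 4)"
    and err: "measure_pmf.prob (pin_source M n P) (atypical M n P \<delta>) + 4 * M * 2 powr (- (real n * \<delta>)) \<le> e"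
    using \<epsilon> by (auto simp: eventually_sequentially field_simps)
  define N where "N = nat \<lceil>2 powr (real n * R)\<rceil>"
  have one: "1 \<le> 2 powr (real n * R)" using R0 by (intro ge_one_powr_ge_zero) auto
  then have N: "2 powr (real n * R) \<le> real N" "real N \<le> 2 * 2 powr (real n * R)" "N > 0"
    unfolding N_def by linarith+
  have logN: "real n * R \<le> log 2 N" "log 2 N \<le> 1 + real n * R"
  proof -
    show "real n * R \<le> log 2 N" using N by (simp add: le_log_iff)
    have "real N \<le> 2 powr (1 + real n * R)" using N by (simp add: powr_add)
    then show "log 2 N \<le> 1 + real n * R" using N by (simp add: log_le_iff)
  qed
  define D where "D = e * log 2 N + (1 + ln (M * (1 + N * (2 ^ M * 2 powr (real n * ((3 * real M + 2) * \<delta> - R)))))) / ln 2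
      + (e * log 2 N - log 2 (1 - e) - e * log 2 e)"
  have D: "D \<le> real n * \<epsilon>"
  proof -
    let ?g = "2 powr (real n * ((3 * real M + 2) * \<delta>)) :: real"
    have g: "?g \<ge> 1" using \<delta> by (intro ge_one_powr_ge_zero) auto
    have "N * (2 ^ M * 2 powr (real n * ((3 * real M + 2) * \<delta> - R)))
       \<le> (2 * 2 powr (real n * R)) * (2 ^ M * 2 powr (real n * ((3 * real M + 2) * \<delta> - R)))"
      using N by (intro mult_right_mono) auto
    also have "\<dots> = 2 ^ (M + 1) * ?g"
      by (simp add: algebra_simps flip: powr_add)
    finally have a: "N * (2 ^ M * 2 powr (real n * ((3 * real M + 2) * \<delta> - R))) \<le> 2 ^ (M + 1) * ?g" .
    have "1 * 1 \<le> 2 ^ (M + 1) * ?g" using g by (intro mult_mono one_le_power) auto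
    moreover have "2 ^ (M + 2) * ?g = 2 ^ (M + 1) * ?g + 2 ^ (M + 1) * ?g" by simp
    \<comment> \<open>\<open>2 ^ M\<close> comes from the bin counts, one more factor 2 from
      rounding \<open>N\<close> up, and one from absorbing the summand 1.\<close>
    ultimately have "1 + N * (2 ^ M * 2 powr (real n * ((3 * real M + 2) * \<delta> - R))) \<le> 2 ^ (M + 2) * ?g"
      using a by linarith
    then have "M * (1 + N * (2 ^ M * 2 powr (real n * ((3 * real M + 2) * \<delta> - R)))) \<le> M * (2 ^ (M + 2) * ?g)"
      by (intro mult_left_mono) auto
    then have "log 2 (M * (1 + N * (2 ^ M * 2 powr (real n * ((3 * real M + 2) * \<delta> - R))))) \<le> log 2 (M * (2 ^ (M + 2) * ?g))"
      using M by (intro log_mono) (auto intro!: mult_pos_pos add_pos_nonneg)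
    also have "\<dots> = log 2 M + (M + 2) + real n * ((3 * real M + 2) * \<delta>)"
      using M log_pow_cancel[of "2::real" 2] by (simp add: log_mult log_nat_power)
    finally have "log 2 (M * (1 + N * (2 ^ M * 2 powr (real n * ((3 * real M + 2) * \<delta> - R)))))
       \<le> log 2 M + (M + 2) + real n * ((3 * real M + 2) * \<delta>)" .
    moreover have "real n * ((3 * real M + 2) * \<delta>) = real n * (\<epsilon> / 4)"
      by (simp add: \<delta>_def field_simps)
    ultimately have 1: "ln (M * (1 + N * (2 ^ M * 2 powr (real n * ((3 * real M + 2) * \<delta> - R))))) / ln 2
       \<le> log 2 M + (M + 2) + real n * (\<epsilon> / 4)"
      unfolding log_def by linarith
    have "2 * e * log 2 N \<le> 2 * e * (1 + real n * R)"
      using logN e by (intro mult_left_mono) auto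
    also have "\<dots> \<le> 2 * e * (real n * (R + 1))"
      using n e by (intro mult_left_mono) (auto simp: algebra_simps)
    also have "\<dots> \<le> real n * (\<epsilon> / 2)"
      using mult_left_mono[OF e(4), of "real n"] by (simp add: mult_ac)
    finally have "2 * e * log 2 N \<le> real n * (\<epsilon> / 2)" .
    then show ?thesis using 1 cn unfolding D_def c_def by (simp add: add_divide_distrib algebra_simps)
  qed
  from code_exists[OF M \<delta> e(1,2) N(3) R err, folded D_def]
  obtain \<phi> :: "nat \<Rightarrow> 'a view \<Rightarrow> nat list \<Rightarrow> nat pmf" and KA KB :: "'a view \<Rightarrow> nat list \<Rightarrow> nat" and L
    where code: "\<forall>x fs. KA x fs \<in> {..<N}" "\<forall>l x fs. set_pmf (\<phi> l x fs) \<subseteq> {..<L}"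
     "measure_pmf.prob (outcome M n P M \<phi>) {w. (\<lambda>(\<omega>, fs). KA (terminal_view M n Alice \<omega>) fs) w
        \<noteq> (\<lambda>(\<omega>, fs). KB (terminal_view M n Bob \<omega>) fs) w} \<le> e"
     "entropy_pmf (map_pmf (\<lambda>(\<omega>, fs). KA (terminal_view M n Alice \<omega>) fs) (outcome M n P M \<phi>)) \<ge> log 2 N - D"
     "\<forall>m\<in>{1..M}. mutual_info_pmf (outcome M n P M \<phi>) (\<lambda>(\<omega>, fs). KA (terminal_view M n Alice \<omega>) fs)
        (\<lambda>(\<omega>, fs). (terminal_view M n (Relay m) \<omega>, fs)) \<le> D"
    unfolding Let_def by (elim exE conjE) (rule that)
  let ?H = "entropy_pmf (map_pmf (\<lambda>(\<omega>, fs). KA (terminal_view M n Alice \<omega>) fs) (outcome M n P M \<phi>))"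
  have H: "log 2 N - real n * \<epsilon> \<le> ?H" using code(4) D by linarith
  have "log 2 N / real n - \<epsilon> = (log 2 N - real n * \<epsilon>) / real n" using n by (simp add: diff_divide_distrib)
  also have "\<dots> \<le> ?H / real n" using H by (intro divide_right_mono) auto
  finally have H1: "log 2 (card {..<N}) / real n - \<epsilon> \<le> ?H / real n" by simp
  moreover have "R \<le> log 2 N / real n" using logN(1) n by (simp add: pos_le_divide_eq mult.commute)
  ultimately have H2: "R - \<epsilon> \<le> ?H / real n" by simp
  have sec: "mutual_info_pmf (outcome M n P M \<phi>) (\<lambda>(\<omega>, fs). KA (terminal_view M n Alice \<omega>) fs)
        (\<lambda>(\<omega>, fs). (terminal_view M n (Relay m) \<omega>, fs)) / real n \<le> \<epsilon>" if "m \<in> {1..M}" for m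
    using bspec[OF code(5) that] D n by (simp add: pos_divide_le_eq mult.commute)
  show "\<exists>(n::nat) (q::nat) (\<phi> :: nat \<Rightarrow> 'a view \<Rightarrow> nat list \<Rightarrow> nat pmf)
         (KA :: 'a view \<Rightarrow> nat list \<Rightarrow> nat) (KB :: 'a view \<Rightarrow> nat list \<Rightarrow> nat)
         (K :: nat set) (L :: nat).
        n > 0 \<and> finite K \<and> (\<forall>x fs. KA x fs \<in> K) \<and>
        (\<forall>l x fs. set_pmf (\<phi> l x fs) \<subseteq> {..<L}) \<and>
        (let \<Omega> = outcome M n P q \<phi>;
             keyA = (\<lambda>(\<omega>, fs). KA (terminal_view M n Alice \<omega>) fs);
             keyB = (\<lambda>(\<omega>, fs). KB (terminal_view M n Bob \<omega>) fs)
         in measure_pmf.prob \<Omega> {w. keyA w \<noteq> keyB w} \<le> \<epsilon>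
          \<and> entropy_pmf (map_pmf keyA \<Omega>) / real n \<ge> R - \<epsilon>
          \<and> entropy_pmf (map_pmf keyA \<Omega>) / real n \<ge> log 2 (real (card K)) / real n - \<epsilon>
          \<and> (\<forall>m\<in>{1..M}.
               mutual_info_pmf \<Omega> keyA
                 (\<lambda>(\<omega>, fs). (terminal_view M n (Relay m) \<omega>, fs)) / real n \<le> \<epsilon>))"
    unfolding Let_def
    by (rule exI[of _ n], rule exI[of _ M], rule exI[of _ \<phi>], rule exI[of _ KA], rule exI[of _ KB],
        rule exI[of _ "{..<N}"], rule exI[of _ L], intro conjI n finite_lessThan code(1,2) H1 H2 ballI sec)
      (use code(3) e(3) in linarith)
qed

section \<open>Capacity\<close>

lemma sum_list_butlast_sort:
  fixes xs :: "real list"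
  assumes "xs \<noteq> []"
  shows "sum_list (take (length xs - 1) (sort xs)) = sum_list xs - Max (set xs)"
proof -
  let ?s = "sort xs"
  have ne: "?s \<noteq> []" using assms by (metis length_0_conv length_sort)
  have split: "?s = butlast ?s @ [last ?s]" using ne by simp
  have max: "last ?s = Max (set xs)"
  proof (rule Max_eqI[symmetric])
    show "last ?s \<in> set xs" using ne last_in_set[of ?s] by simp
    show "y \<le> last ?s" if "y \<in> set xs" for y
    proof -
      have "y \<in> set (butlast ?s @ [last ?s])" using that split by (metis set_sort)
      moreover have "sorted (butlast ?s @ [last ?s])" using split by (metis sorted_sort)
      ultimately show ?thesis by (auto simp: sorted_append)
    qed
  qed simp
  have "sum_list xs = sum_list ?s"
    by (metis mset_sort sum_mset_sum_list)
  also have "\<dots> = sum_list (butlast ?s) + last ?s" by (subst split) simp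
  finally show ?thesis using max by (simp add: butlast_conv_take)
qed

theorem theorem1:
  fixes M :: nat and P :: "nat \<Rightarrow> party \<Rightarrow> ('a::finite \<times> 'a) pmf"
  assumes "M \<ge> 2"
  shows "private_key_capacity M P
           = (\<Sum>i=1..M. pin_rate P i) - Max (pin_rate P ` {1..M})
       \<and> private_key_capacity M P
           = sum_list (take (M - 1) (sort (map (pin_rate P) [1..<M+1])))"
proof -
  let ?R = "(\<Sum>i=1..M. pin_rate P i) - Max (pin_rate P ` {1..M})"
  have cut: "(\<Sum>i\<in>{1..M} - {m}. pin_rate P i) = (\<Sum>i=1..M. pin_rate P i) - pin_rate P m"
    if "m \<in> {1..M}" for m
    using that by (simp add: sum_diff1)
  \<comment> \<open>The relay with the largest rate gives the tightest cut: it bounds the capacity,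
    and its rate lies below all the other cuts, as achievability requires.\<close>
  have "Max (pin_rate P ` {1..M}) \<in> pin_rate P ` {1..M}"
    using assms by (intro Max_in) auto
  then obtain m where m: "m \<in> {1..M}" "Max (pin_rate P ` {1..M}) = pin_rate P m" by blast
  have "achievable M P ?R"
  proof (rule cut_achievable)
    show "0 \<le> ?R"
      unfolding m(2) cut[OF m(1), symmetric] by (intro sum_nonneg pin_rate_bounds(1))
    show "\<forall>m'\<in>{1..M}. ?R \<le> (\<Sum>i\<in>{1..M} - {m'}. pin_rate P i)"
    proof
      fix m' assume m': "m' \<in> {1..M}"
      then have "pin_rate P m' \<le> Max (pin_rate P ` {1..M})" by (intro Max_ge) auto
      then show "?R \<le> (\<Sum>i\<in>{1..M} - {m'}. pin_rate P i)" unfolding cut[OF m'] by simp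
    qed
  qed (use assms in simp)
  moreover have "R \<le> ?R" if "achievable M P R" for R
    using achievable_le_cut[OF that m(1)] unfolding cut[OF m(1)] m(2) .
  ultimately have cap: "private_key_capacity M P = ?R"
    unfolding private_key_capacity_def by (intro cSup_eq_maximum) auto
  have "sum_list (take (M - 1) (sort (map (pin_rate P) [1..<M+1]))) = ?R"
    using sum_list_butlast_sort[of "map (pin_rate P) [1..<M+1]"] assms
    by (simp add: sum_set_upt_conv_sum_list_nat atLeastLessThanSuc_atLeastAtMost interv_sum_list_conv_sum_set_nat del: upt_Suc)
  then show ?thesis using cap by simp
qed

end
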